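(* Let $H \neq \{0\}$ be a finite-dimensional real Hilbert space, let $\pi_i : H \to H_i$, $i=1,\ldots,N$, be real linear maps into real Hilbert spaces $H_i$, and let $\tau_1,\ldots,\tau_N \in [0,1]$. Then the following are equivalent: (1) There exists a finite constant $C$ such that $$\int_{H} \prod_{i=1}^N [f_i(\pi_i(x))]^{\tau_i}\, dx \leq C \prod_{i=1}^N \left[ \int_{\pi_i(H)} f_i(x_i)\, dx_i \right]^{\tau_i}$$ for all nonnegative Lebesgue-measurable functions $f_i$ on $\pi_i(H)$, $i = 1,\ldots,N$. (2) There exist a graph decomposition $\mathcal{G}$ of $H$ and weights $\theta_1,\ldots,\theta_N$ on the edges of $\mathcal{G}$ such that $(\mathcal{G},\{\theta_i\}_{i=1}^N)$ is a valid presentation of the data $(H,\{\pi_i\}_{i=1}^N,\{\tau_i\}_{i=1}^N)$.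
   Context: A graph decomposition of a finite-dimensional real Hilbert space $H$ is a finite directed graph $\mathcal{G}$ whose vertex set $\mathcal{V}(\mathcal{G})$ consists of subspaces of $H$, with both $\{0\}$ and $H$ belonging to $\mathcal{V}(\mathcal{G})$, and whose edge set $\mathcal{E}(\mathcal{G})$ satisfies: (i) for every edge outgoing from $V_1$ and incoming to $V_2$ (that is, directed from $V_1$ to $V_2$), one has $V_1 \subset V_2$ and $\dim V_2 = \dim V_1 + 1$; (ii) every vertex other than $\{0\}$ has at least one incoming edge; (iii) every vertex other than $H$ has at least one outgoing edge. A real scalar- or vector-valued function $\varphi$ on $\mathcal{E}(\mathcal{G})$ is balanced when for every vertex $V \in \mathcal{V}(\mathcal{G})$ with $V \neq \{0\}$ and $V \neq H$, the sum of $\varphi(e)$ over all edges $e$ incoming to $V$ equals the sum of $\varphi(e')$ over all edges $e'$ outgoing from $V$. The total mass of $\varphi$ is the sum of $\varphi(e)$ over all edges $e$ outgoing from $\{0\}$. Given maps $\{\pi_i\}_{i=1}^N$, a graph decomposition $\mathcal{G}$ of $H$, and nonnegative real-valued balanced weights $\theta_1,\ldots,\theta_N$ on $\mathcal{E}(\mathcal{G})$ such that $\theta_i$ has total mass $\tau_i$ for each $i$, the summary weight $\sigma$ is defined on each edge $e$, directed from $V_1$ to $V_2$, by letting $\sigma(e)$ be the sum of $\theta_i(e)$ over all $i$ such that $\pi_i(V_1) \neq \pi_i(V_2)$. When $\sigma$ is balanced with total mass $1$, $(\mathcal{G},\{\theta_i\}_{i=1}^N)$ is called a valid presentation of $(H,\{\pi_i\}_{i=1}^N,\{\tau_i\}_{i=1}^N)$.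 Integrals over $H$ and $\pi_i(H)$ are with respect to Lebesgue measure normalized by the Hilbert space structure ($\pi_i(H)$ has the inner product inherited from $H_i$); on $\{0\}$ the measure is the unit point mass. Conventions: any quantity raised to the power $0$ equals $1$, and $0 \cdot \infty = 0$. *)

theory Defs
  imports "HOL-Analysis.Analysis" "Graph_Theory.Pair_Digraph"
begin

definition orthonormal_basis_of :: "'b::real_inner set \<Rightarrow> 'b set \<Rightarrow> bool" where
  "orthonormal_basis_of V B \<longleftrightarrow>
     finite B \<and> pairwise orthogonal B \<and> (\<forall>b\<in>B. norm b = 1) \<and> span B = V"

text \<open>
  The constant \<open>lborel\<close> would give a proper subspace measure zero (and needs a
  finite-dimensional ambient space), so the product Lebesgue measure on coordinates is
  transported to \<open>V\<close> along an orthonormal basis. By rotation invariance the result does not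
  depend on the basis. For \<open>V = {0}\<close> the basis is empty and the result is the unit point mass
  at \<open>0\<close>. The definition is only meaningful when \<open>V\<close> is a finite-dimensional subspace.
\<close>

definition subspace_lborel :: "'b::real_inner set \<Rightarrow> 'b measure" where
  "subspace_lborel V =
     (let B = (SOME B. orthonormal_basis_of V B)
      in distr (PiM B (\<lambda>_. lborel)) (restrict_space borel V) (\<lambda>c. \<Sum>b\<in>B. c b *\<^sub>R b))"

definition subspace_lebesgue :: "'b::real_inner set \<Rightarrow> 'b measure" where
  "subspace_lebesgue V = completion (subspace_lborel V)"

text \<open>
  For exponents \<open>p \<ge> 0\<close> only. The library's \<open>powr\<close> has \<open>0 powr 0 = 0\<close>, whereas here every
  quantity to the power \<open>0\<close>, including \<open>0\<close> and \<open>\<infinity>\<close>, is \<open>1\<close>.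
  Multiplication on \<open>ennreal\<close> already satisfies \<open>0 * \<infinity> = 0\<close>.
\<close>

definition ennreal_powr :: "ennreal \<Rightarrow> real \<Rightarrow> ennreal" where
  "ennreal_powr x p =
     (if p = 0 then 1 else if x = \<infinity> then \<infinity> else ennreal (enn2real x powr p))"

locale graph_decomposition = pair_fin_digraph G
  for G :: "'a::euclidean_space set pair_pre_digraph" +
  assumes verts_subspace: "V \<in> pverts G \<Longrightarrow> subspace V"
    and zero_vert: "{0} \<in> pverts G"
    and UNIV_vert: "UNIV \<in> pverts G"
    and arc_subset: "(V1, V2) \<in> parcs G \<Longrightarrow> V1 \<subset> V2"
    and arc_dim: "(V1, V2) \<in> parcs G \<Longrightarrow> dim V2 = dim V1 + 1"
    and incoming: "V \<in> pverts G \<Longrightarrow> V \<noteq> {0} \<Longrightarrow> in_arcs (with_proj G) V \<noteq> {}"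
    and outgoing: "V \<in> pverts G \<Longrightarrow> V \<noteq> UNIV \<Longrightarrow> out_arcs (with_proj G) V \<noteq> {}"

definition balanced ::
    "'a::euclidean_space set pair_pre_digraph \<Rightarrow> ('a set \<times> 'a set \<Rightarrow> 'v::real_vector) \<Rightarrow> bool" where
  "balanced G \<phi> \<longleftrightarrow>
     (\<forall>V\<in>pverts G. V \<noteq> {0} \<longrightarrow> V \<noteq> UNIV \<longrightarrow>
        (\<Sum>e\<in>in_arcs (with_proj G) V. \<phi> e) = (\<Sum>e\<in>out_arcs (with_proj G) V. \<phi> e))"

definition total_mass ::
    "'a::euclidean_space set pair_pre_digraph \<Rightarrow> ('a set \<times> 'a set \<Rightarrow> 'v::real_vector) \<Rightarrow> 'v" where
  "total_mass G \<phi> = (\<Sum>e\<in>out_arcs (with_proj G) {0}. \<phi> e)"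

definition summary_weight ::
    "nat \<Rightarrow> (nat \<Rightarrow> 'a \<Rightarrow> 'b) \<Rightarrow> (nat \<Rightarrow> 'a set \<times> 'a set \<Rightarrow> real) \<Rightarrow> 'a set \<times> 'a set \<Rightarrow> real" where
  "summary_weight N \<pi> \<theta> = (\<lambda>(V1, V2). \<Sum>i | i \<in> {1..N} \<and> \<pi> i ` V1 \<noteq> \<pi> i ` V2. \<theta> i (V1, V2))"

definition valid_presentation ::
    "'a::euclidean_space set pair_pre_digraph \<Rightarrow> (nat \<Rightarrow> 'a set \<times> 'a set \<Rightarrow> real) \<Rightarrow>
     nat \<Rightarrow> (nat \<Rightarrow> 'a \<Rightarrow> 'b) \<Rightarrow> (nat \<Rightarrow> real) \<Rightarrow> bool" where
  "valid_presentation G \<theta> N \<pi> \<tau> \<longleftrightarrow>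
     graph_decomposition G \<and>
     (\<forall>i\<in>{1..N}. (\<forall>e\<in>parcs G. 0 \<le> \<theta> i e) \<and> balanced G (\<theta> i) \<and> total_mass G (\<theta> i) = \<tau> i) \<and>
     balanced G (summary_weight N \<pi> \<theta>) \<and>
     total_mass G (summary_weight N \<pi> \<theta>) = 1"

end

theory Submission
  imports Defs
begin

text \<open>
  Both statements are equivalent to a condition on dimensions: \<open>dim V \<le> \<Sum>\<^sub>i \<tau>\<^sub>i dim \<pi>\<^sub>i(V)\<close> for all
  subspaces \<open>V\<close> of \<open>H\<close>, with equality for \<open>V = H\<close> (the theorem of Bennett, Carbery, Christ and Tao for
  the inequality). The condition is \<open>feasible\<close>.

  It is necessary for each statement. If the inequality holds, testing it with indicators of boxes that are
  long along \<open>V\<close> compares powers of the length (\<open>brascamp_lieb_imp_feasible\<close>). If there is a presentation,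
  summing the increments of the potential \<open>dim (X \<inter> V)\<close> against the summary weight, and of corresponding
  potentials against the \<open>\<theta>\<^sub>i\<close>, gives the condition for \<open>X\<close> (\<open>valid_presentation_imp_feasible\<close>).

  It is sufficient for each statement by one and the same induction (\<open>feasible_induct\<close>), carried out for
  quotients \<open>W / U\<close> of nested subspaces. If some \<open>V\<close> strictly between \<open>U\<close> and \<open>W\<close> attains equality, both \<open>V / U\<close>
  and \<open>W / V\<close> satisfy the condition, and it remains to combine what is known for them. If no such \<open>V\<close>
  exists and \<open>W / U\<close> is not a line, at least two exponents are strictly between \<open>0\<close> and \<open>1\<close>; they
  can be moved against each other, in both directions, until a new constraint becomes tight, which exhibits
  \<open>\<tau>\<close> as a convex combination of exponents that are closer to the end of the induction. So a
  property of exponents follows from the condition as soon as it holds for lines, can be glued along a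
  subspace, and is stable under convex combinations.

  For the inequality these three steps are Hoelder's inequality on a line, Tonelli's theorem, and
  Hoelder's inequality with two exponents. For presentations they are a graph with a single edge, the
  concatenation of two graphs, and the weighted superposition of two graphs.

  To avoid quotient spaces and measures on them, functions on \<open>\<pi>\<^sub>i(H)\<close> are pulled back to \<open>H\<close>, and integrals over
  \<open>W / U\<close> are iterated integrals along lines in the directions of a basis of \<open>W\<close> modulo \<open>U\<close>. Changing
  the basis changes such an integral by a constant factor (\<open>iter_int_change_chain\<close>), which is harmless as only
  the finiteness of the constant matters.
\<close>

section \<open>Dimension conditions and induction on feasible exponents\<close>

lemma zero_neq_UNIV: "{0::'a::euclidean_space} \<noteq> UNIV"
  by (metis UNIV_I nonempty_Basis nonzero_Basis singletonD all_not_in_conv)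

lemma span_insert_subset:
  assumes "subspace W" "U \<subseteq> W" "w \<in> W"
  shows "span (insert w U) \<subseteq> W"
  using assms by (intro span_minimal) auto

lemma dim_psubset_subspace:
  fixes U V :: "'a::euclidean_space set"
  assumes "subspace U" "subspace V" "U \<subset> V"
  shows "dim U < dim V"
  using assms dim_psubset[of U V] by (simp add: span_eq_iff[THEN iffD2])

lemma subspace_eqI_dim:
  fixes U V :: "'a::euclidean_space set"
  assumes "subspace U" "subspace V" "U \<subseteq> V" "dim V \<le> dim U"
  shows "U = V"
  using assms subspace_dim_equal by blast

text \<open>
  A pair \<open>(a, b)\<close> stands for the affine constraint \<open>a + t b \<ge> 0\<close>, which is slack at \<open>t = 0\<close>. The
  time wanted is the least of the quotients \<open>a / - b\<close> over the decreasing constraints.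
\<close>

lemma first_tight_time:
  fixes P :: "(real \<times> real) set"
  assumes "finite P" "\<And>p. p \<in> P \<Longrightarrow> fst p > 0" "\<exists>p\<in>P. snd p < 0"
  shows "\<exists>t>0. (\<forall>p\<in>P. 0 \<le> fst p + t * snd p) \<and> (\<exists>p\<in>P. fst p + t * snd p = 0)"
proof -
  define Q where "Q = {p\<in>P. snd p < 0}"
  define R where "R = (\<lambda>p. fst p / - snd p) ` Q"
  have R: "finite R" "R \<noteq> {}" using assms unfolding R_def Q_def by (simp, blast)
  define t where "t = Min R"
  have "t \<in> R" unfolding t_def using R by (rule Min_in)
  then obtain p where p: "p \<in> P" "snd p < 0" "t = fst p / - snd p"
    by (auto simp: R_def Q_def)
  have "t > 0" using p(2,3) assms(2)[OF p(1)] divide_pos_pos[of "fst p" "- snd p"] by simp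
  moreover have "0 \<le> fst q + t * snd q" if "q \<in> P" for q
  proof (cases "snd q < 0")
    case True
    then have "t \<le> fst q / - snd q"
      unfolding t_def using that R by (intro Min_le) (auto simp: R_def Q_def)
    then show ?thesis using True by (simp add: field_simps)
  next
    case False
    then show ?thesis using \<open>t > 0\<close> assms(2)[OF that]
      by (intro add_nonneg_nonneg mult_nonneg_nonneg) auto
  qed
  moreover have "fst p + t * snd p = 0" using p by (simp add: field_simps)
  ultimately show ?thesis using p by blast
qed

text \<open>
  In the application \<open>K i\<close> is the kernel of \<open>\<pi>\<^sub>i\<close>. Pulling everything back along \<open>\<pi>\<^sub>i\<close> keeps the
  whole argument inside the one space \<open>H\<close>: a function on \<open>\<pi>\<^sub>i(H)\<close> becomes a \<open>K i\<close>-invariant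
  function on \<open>H\<close>, and \<open>\<pi>\<^sub>i(V)\<close> becomes its preimage \<open>V + K i\<close>.
\<close>

locale subspace_arrangement =
  fixes N :: nat and K :: "nat \<Rightarrow> 'a::euclidean_space set"
begin

definition join :: "nat \<Rightarrow> 'a set \<Rightarrow> 'a set" where "join i V = span (V \<union> K i)"

text \<open>
  Since \<open>dim \<pi>\<^sub>i(V) = dim (V + K i) - dim (K i)\<close>, differences of the excess are the differences of
  \<open>\<Sum>\<^sub>i \<tau>\<^sub>i dim \<pi>\<^sub>i(V) - dim V\<close>.
\<close>

definition excess :: "(nat \<Rightarrow> real) \<Rightarrow> 'a set \<Rightarrow> real" where
  "excess \<tau> V = (\<Sum>i=1..N. \<tau> i * real (dim (join i V))) - real (dim V)"

text \<open>
  These are the dimension conditions for the maps that the \<open>\<pi>\<^sub>i\<close> induce on the quotient \<open>W / U\<close>.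
  Working with intervals of subspaces instead of quotients makes restriction to a subspace and
  passage to a quotient the same operation, namely shortening the interval.
\<close>

definition feasible :: "(nat \<Rightarrow> real) \<Rightarrow> 'a set \<Rightarrow> 'a set \<Rightarrow> bool" where
  "feasible \<tau> U W \<longleftrightarrow> excess \<tau> W = excess \<tau> U \<and>
     (\<forall>V. subspace V \<and> U \<subseteq> V \<and> V \<subseteq> W \<longrightarrow> excess \<tau> U \<le> excess \<tau> V)"

definition admissible :: "(nat \<Rightarrow> real) \<Rightarrow> bool" where
  "admissible \<tau> \<longleftrightarrow> (\<forall>i\<in>{1..N}. 0 \<le> \<tau> i \<and> \<tau> i \<le> 1)"

definition critical :: "(nat \<Rightarrow> real) \<Rightarrow> 'a set \<Rightarrow> 'a set \<Rightarrow> 'a set \<Rightarrow> bool" where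
  "critical \<tau> U W V \<longleftrightarrow> subspace V \<and> U \<subset> V \<and> V \<subset> W \<and> excess \<tau> V = excess \<tau> U"

lemma subspace_join [simp]: "subspace (join i V)"
  by (simp add: join_def)

lemma join_mono: "U \<subseteq> V \<Longrightarrow> join i U \<subseteq> join i V"
  unfolding join_def by (intro span_mono) auto

lemma subset_join: "V \<subseteq> join i V"
  unfolding join_def by (meson Un_upper1 order_trans span_superset)

lemma join_dim_mono: "U \<subseteq> V \<Longrightarrow> dim (join i U) \<le> dim (join i V)"
  by (intro dim_subset join_mono)

lemma join_insert: "join i (span (insert w U)) = span (insert w (join i U))"
proof -
  have "span (insert w (span (U \<union> K i))) = span (insert w (U \<union> K i))"
    by (simp only: span_insert span_span)
  moreover have "span (span (insert w U) \<union> K i) = span (insert w (U \<union> K i))"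
    by (simp only: span_Un span_span flip: Un_insert_left)
  ultimately show ?thesis by (simp add: join_def)
qed

lemma join_dim_insert:
  "dim (join i (span (insert w U))) = dim (join i U) + (if w \<in> join i U then 0 else 1)"
  by (simp add: join_insert dim_insert span_eq_iff[THEN iffD2])

lemma dim_step_span_insert:
  fixes U W :: "'a set"
  assumes "subspace U" "subspace W" "U \<subseteq> W" "dim W = dim U + 1"
  shows "\<exists>w. w \<notin> U \<and> W = span (insert w U)"
proof -
  have "U \<noteq> W" using assms(4) by auto
  then obtain w where w: "w \<in> W" "w \<notin> U" using assms(3) by blast
  have "span (insert w U) = W"
    using assms w by (intro subspace_eqI_dim) (auto simp: span_insert_subset dim_insert span_eq_iff[THEN iffD2])
  then show ?thesis using w by auto
qed

text \<open>
  The dimension count for the map that \<open>\<pi>\<^sub>i\<close> induces on \<open>W / U\<close>, whose kernel is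
  \<open>(W \<inter> (U + K i)) / U\<close>.
\<close>

lemma join_modular:
  assumes "subspace U" "subspace W" "U \<subseteq> W"
  shows "dim (W \<inter> join i U) + dim (join i W) = dim W + dim (join i U)"
    and "join i (W \<inter> join i U) = join i U"
proof -
  have "span (W \<union> join i U) = join i W"
  proof
    show "span (W \<union> join i U) \<subseteq> join i W"
      using subset_join[of W i] join_mono[OF assms(3)] by (intro span_minimal) auto
    show "join i W \<subseteq> span (W \<union> join i U)"
    proof -
      have "K i \<subseteq> join i U" unfolding join_def by (meson Un_upper2 order_trans span_superset)
      then show ?thesis unfolding join_def[of i W] by (intro span_mono) auto
    qed
  qed
  moreover have "span (W \<union> join i U) = {x + y |x y. x \<in> W \<and> y \<in> join i U}"
    using assms by (simp add: span_Un span_eq_iff[THEN iffD2])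
  ultimately show "dim (W \<inter> join i U) + dim (join i W) = dim W + dim (join i U)"
    using dim_sums_Int[of W "join i U"] assms by simp
  show "join i (W \<inter> join i U) = join i U"
  proof
    have "K i \<subseteq> join i U" unfolding join_def by (meson Un_upper2 order_trans span_superset)
    then show "join i (W \<inter> join i U) \<subseteq> join i U"
      unfolding join_def[of i "W \<inter> _"] by (intro span_minimal) auto
    show "join i U \<subseteq> join i (W \<inter> join i U)"
      using subset_join[of U i] assms by (intro join_mono) auto
  qed
qed

lemma join_dim_diff_le:
  assumes "subspace U" "subspace W" "U \<subseteq> W"
  shows "real (dim (join i W)) - real (dim (join i U)) \<le> real (dim W) - real (dim U)"
proof -
  have "dim U \<le> dim (W \<inter> join i U)"
    using assms subset_join[of U i] by (intro dim_subset) auto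
  with join_modular(1)[OF assms, of i] show ?thesis by linarith
qed

lemma excess_diff:
  "excess \<tau> W - excess \<tau> U =
     (\<Sum>i=1..N. \<tau> i * (real (dim (join i W)) - real (dim (join i U)))) - (real (dim W) - real (dim U))"
  by (simp add: excess_def sum_subtractf right_diff_distrib)

text \<open>
  A critical subspace cuts the problem in two: it attains the minimum of the excess, so it can serve
  as the upper end of one interval and the lower end of the other.
\<close>

lemma feasible_split:
  assumes "feasible \<tau> U W" "critical \<tau> U W V"
  shows "feasible \<tau> U V" "feasible \<tau> V W"
proof -
  have 1: "excess \<tau> W = excess \<tau> U" "excess \<tau> V = excess \<tau> U" "U \<subseteq> V" "V \<subseteq> W"
    and 2: "\<And>X. subspace X \<Longrightarrow> U \<subseteq> X \<Longrightarrow> X \<subseteq> W \<Longrightarrow> excess \<tau> U \<le> excess \<tau> X"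
    using assms by (auto simp: feasible_def critical_def)
  show "feasible \<tau> U V" unfolding feasible_def using 1 2 by (meson order_trans)
  show "feasible \<tau> V W" unfolding feasible_def using 1 2 by (metis order_trans)
qed

text \<open>
  If \<open>\<tau>\<^sub>i = 1\<close>, the kernel \<open>V\<close> of the \<open>i\<close>-th map on \<open>W / U\<close> is critical: the \<open>i\<close>-th term loses
  exactly \<open>dim W - dim V\<close> between \<open>W\<close> and \<open>V\<close>, and the other terms can only decrease further. The map is
  not zero, so \<open>V\<close> is not all of \<open>W\<close>. If \<open>V = U\<close>, the \<open>i\<close>-th term alone already accounts for the
  whole dimension of \<open>W / U\<close>, which makes all intermediate subspaces critical.
\<close>

lemma full_exponent_critical:
  assumes UW: "subspace U" "subspace W" "U \<subseteq> W" and dim: "dim W \<ge> dim U + 2"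
    and adm: "admissible \<tau>" and feas: "feasible \<tau> U W"
    and i: "i \<in> {1..N}" "\<tau> i = 1" "dim (join i U) < dim (join i W)"
  shows "\<exists>V. critical \<tau> U W V"
proof -
  define D where "D j V = real (dim (join j V)) - real (dim (join j U))" for j V
  define r where "r V = real (dim V) - real (dim U)" for V :: "'a set"
  have ex: "excess \<tau> V - excess \<tau> U = D i V + (\<Sum>j\<in>{1..N}-{i}. \<tau> j * D j V) - r V" for V
    unfolding excess_diff D_def r_def using i by (subst sum.remove[of _ i]) auto
  have W0: "D i W + (\<Sum>j\<in>{1..N}-{i}. \<tau> j * D j W) - r W = 0"
    using feas ex[of W] by (simp add: feasible_def)
  have rest: "(\<Sum>j\<in>{1..N}-{i}. \<tau> j * D j V) \<le> (\<Sum>j\<in>{1..N}-{i}. \<tau> j * D j W)" if "V \<subseteq> W" for V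
  proof (intro sum_mono mult_left_mono)
    show "D j V \<le> D j W" for j unfolding D_def using join_dim_mono[OF that, of j] by simp
    show "0 \<le> \<tau> j" if "j \<in> {1..N} - {i}" for j using adm that by (auto simp: admissible_def)
  qed
  have nonneg: "excess \<tau> U \<le> excess \<tau> V" if "subspace V" "U \<subseteq> V" "V \<subseteq> W" for V
    using feas that by (simp add: feasible_def)
  define V where "V = W \<inter> join i U"
  have V: "subspace V" "U \<subseteq> V" "V \<subseteq> W"
    using UW subset_join[of U i] by (auto simp: V_def subspace_inter)
  have DV: "D i V = 0" "r W - r V = D i W"
    using join_modular[OF UW, of i] by (simp_all add: V_def D_def r_def)
  have "excess \<tau> V = excess \<tau> U"
    using ex[of V] rest[OF V(3)] nonneg[OF V] W0 DV by linarith
  moreover have "V \<noteq> W" using DV i by (auto simp: D_def)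
  ultimately show ?thesis
  proof (cases "V = U")
    case False
    with V \<open>V \<noteq> W\<close> \<open>excess \<tau> V = _\<close> show ?thesis by (auto simp: critical_def)
  next
    case True
    \<comment> \<open>the \<open>i\<close>-th map is injective on \<open>W / U\<close>\<close>
    then have r: "r W = D i W" using DV(2) by (simp add: r_def)
    obtain w where w: "w \<in> W" "w \<notin> U" using \<open>V \<noteq> W\<close> True V by auto
    define V' where "V' = span (insert w U)"
    have V': "subspace V'" "U \<subseteq> V'" "V' \<subseteq> W" "dim V' = dim U + 1" "w \<in> V'"
      using w UW by (auto simp: V'_def dim_insert span_eq_iff[THEN iffD2] span_insert_subset span_base)
    have "D i V' \<le> r V'" using join_dim_diff_le[OF UW(1) V'(1,2), of i] by (simp add: D_def r_def)
    then have "excess \<tau> V' = excess \<tau> U"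
      using ex[of V'] rest[OF V'(3)] nonneg[OF V'(1-3)] W0 r by linarith
    then show ?thesis using V' w dim by (auto simp: critical_def intro!: exI[of _ V'])
  qed
qed

text \<open>
  Without critical subspaces no relevant exponent equals \<open>1\<close>. One exponent below \<open>1\<close> cannot balance
  \<open>dim W - dim U\<close> alone, because the rank of a map on \<open>W / U\<close> is at most that dimension.
\<close>

lemma two_fractional_exponents:
  assumes UW: "subspace U" "subspace W" "U \<subseteq> W" and dim: "dim W \<ge> dim U + 2"
    and adm: "admissible \<tau>" and feas: "feasible \<tau> U W"
    and nocrit: "\<nexists>V. critical \<tau> U W V"
  shows "\<exists>i j. i \<in> {1..N} \<and> j \<in> {1..N} \<and> i \<noteq> j \<and>
    0 < \<tau> i \<and> \<tau> i < 1 \<and> dim (join i U) < dim (join i W) \<and>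
    0 < \<tau> j \<and> \<tau> j < 1 \<and> dim (join j U) < dim (join j W)"
proof -
  define D where "D j = real (dim (join j W)) - real (dim (join j U))" for j
  define r where "r = real (dim W) - real (dim U)"
  define I where "I = {i\<in>{1..N}. 0 < \<tau> i \<and> 0 < D i}"
  have lt1: "\<tau> i < 1" if "i \<in> I" for i
  proof -
    have "\<tau> i \<noteq> 1"
      using full_exponent_critical[OF UW dim adm feas, of i] nocrit that
      by (auto simp: I_def D_def)
    moreover have "\<tau> i \<le> 1" using adm that by (auto simp: I_def admissible_def)
    ultimately show ?thesis by simp
  qed
  have D0: "0 \<le> D i" for i unfolding D_def using join_dim_mono[OF UW(3), of i] by simp
  have Dr: "D i \<le> r" for i using join_dim_diff_le[OF UW] by (simp add: D_def r_def)
  have "(\<Sum>i=1..N. \<tau> i * D i) = r"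
    using feas excess_diff[of \<tau> W U] by (simp add: feasible_def D_def r_def)
  moreover have "(\<Sum>i=1..N. \<tau> i * D i) = (\<Sum>i\<in>I. \<tau> i * D i)"
  proof (rule sum.mono_neutral_right)
    show "\<forall>i\<in>{1..N} - I. \<tau> i * D i = 0"
    proof
      fix i assume i: "i \<in> {1..N} - I"
      then have "\<not> 0 < \<tau> i \<or> \<not> 0 < D i" by (auto simp: I_def)
      moreover have "0 \<le> \<tau> i" using adm i by (auto simp: admissible_def)
      ultimately have "\<tau> i = 0 \<or> D i = 0" using D0[of i] by linarith
      then show "\<tau> i * D i = 0" by auto
    qed
  qed (auto simp: I_def)
  ultimately have sum: "(\<Sum>i\<in>I. \<tau> i * D i) = r" by simp
  have "r > 0" using dim by (simp add: r_def)
  with sum have "I \<noteq> {}" by auto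
  then obtain i where i: "i \<in> I" by auto
  have "\<exists>j. j \<in> I \<and> j \<noteq> i"
  proof (rule ccontr)
    assume "\<nexists>j. j \<in> I \<and> j \<noteq> i"
    then have "I = {i}" using i by blast
    then have "\<tau> i * D i = r" using sum by simp
    moreover have "\<tau> i * D i < 1 * D i"
      using lt1[OF i] i by (intro mult_strict_right_mono) (simp_all add: I_def)
    ultimately show False using Dr[of i] by simp
  qed
  then obtain j where j: "j \<in> I" "j \<noteq> i" by auto
  show ?thesis
    by (rule exI[of _ i], rule exI[of _ j])
      (use i j lt1[OF i] lt1[OF j(1)] in \<open>auto simp: I_def D_def\<close>)
qed

text \<open>
  The direction is chosen so that the excess of \<open>W\<close> relative to \<open>U\<close> does not change with \<open>t\<close>.
\<close>

definition shift :: "'a set \<Rightarrow> 'a set \<Rightarrow> nat \<Rightarrow> nat \<Rightarrow> (nat \<Rightarrow> real) \<Rightarrow> real \<Rightarrow> nat \<Rightarrow> real" where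
  "shift U W i j \<tau> t = (\<lambda>k. \<tau> k
     + (if k = i then t / (real (dim (join i W)) - real (dim (join i U))) else 0)
     - (if k = j then t / (real (dim (join j W)) - real (dim (join j U))) else 0))"

text \<open>
  There are infinitely many subspaces, but the excess and its derivative along a shift depend only on
  the dimensions of \<open>V\<close> and of the \<open>V + K k\<close>, so they define only finitely many constraints.
\<close>

lemma finite_excess_values:
  "finite ((\<lambda>V. (excess \<tau> V - c, real (dim (join i V)) / a - real (dim (join j V)) / b - d)) ` S)"
proof -
  define enc where "enc V = (dim V, dim (join i V), dim (join j V), \<lambda>k\<in>{1..N}. dim (join k V))" for V :: "'a set"
  define dec where "dec = (\<lambda>(m::nat, p::nat, q::nat, h::nat\<Rightarrow>nat).
    ((\<Sum>i=1..N. \<tau> i * real (h i)) - real m - c, real p / a - real q / b - d))"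
  let ?n = "DIM('a)"
  have "enc ` S \<subseteq> {..?n} \<times> {..?n} \<times> {..?n} \<times> ({1..N} \<rightarrow>\<^sub>E {..?n})"
    by (auto simp: enc_def dim_subset_UNIV)
  then have "finite (enc ` S)"
    by (rule finite_subset) (auto intro!: finite_PiE)
  then have "finite (dec ` enc ` S)" by simp
  moreover have "dec (enc V) = (excess \<tau> V - c, real (dim (join i V)) / a - real (dim (join j V)) / b - d)" for V
    by (simp add: enc_def dec_def excess_def)
  ultimately show ?thesis by (simp add: image_image)
qed

text \<open>
  Moving the exponents until a constraint becomes tight either produces a critical subspace or makes
  one of the two moved exponents equal to \<open>0\<close> or \<open>1\<close>.
\<close>

lemma shift_until_tight:
  assumes UW: "subspace U" "subspace W" "U \<subseteq> W"
    and adm: "admissible \<tau>" and feas: "feasible \<tau> U W"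
    and nocrit: "\<nexists>V. critical \<tau> U W V"
    and ij: "i \<in> {1..N}" "j \<in> {1..N}" "i \<noteq> j"
    and ti: "0 < \<tau> i" "\<tau> i < 1" "dim (join i U) < dim (join i W)"
    and tj: "0 < \<tau> j" "\<tau> j < 1" "dim (join j U) < dim (join j W)"
  shows "\<exists>t>0. admissible (shift U W i j \<tau> t) \<and> feasible (shift U W i j \<tau> t) U W \<and>
     ((\<exists>V. critical (shift U W i j \<tau> t) U W V) \<or>
      card {k\<in>{1..N}. 0 < shift U W i j \<tau> t k \<and> shift U W i j \<tau> t k < 1}
        < card {k\<in>{1..N}. 0 < \<tau> k \<and> \<tau> k < 1})"
proof -
  define Di where "Di = real (dim (join i W)) - real (dim (join i U))"
  define Dj where "Dj = real (dim (join j W)) - real (dim (join j U))"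
  have D: "Di > 0" "Dj > 0" using ti tj by (auto simp: Di_def Dj_def)
  define s where "s V = real (dim (join i V)) / Di - real (dim (join j V)) / Dj" for V
  define \<sigma> where "\<sigma> t = shift U W i j \<tau> t" for t
  have \<sigma>: "\<sigma> t k = \<tau> k + (if k = i then t / Di else 0) - (if k = j then t / Dj else 0)" for t k
    by (simp add: \<sigma>_def shift_def Di_def Dj_def)
  have exc: "excess (\<sigma> t) V = excess \<tau> V + t * s V" for t V
  proof -
    have "(\<Sum>k=1..N. \<sigma> t k * real (dim (join k V))) = (\<Sum>k=1..N. \<tau> k * real (dim (join k V))
       + (if k = i then t / Di * real (dim (join i V)) else 0) - (if k = j then t / Dj * real (dim (join j V)) else 0))"
      by (intro sum.cong) (auto simp: \<sigma> algebra_simps)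
    also have "\<dots> = (\<Sum>k=1..N. \<tau> k * real (dim (join k V))) + t * s V"
      using ij by (simp add: sum.distrib sum_subtractf s_def right_diff_distrib)
    finally show ?thesis by (simp add: excess_def)
  qed
  have sW: "s W = s U"
  proof -
    have "s W - s U = Di / Di - Dj / Dj"
      unfolding s_def by (subst (3) Di_def, subst (3) Dj_def) (simp add: diff_divide_distrib)
    with D show ?thesis by simp
  qed
  define S where "S = {V. subspace V \<and> U \<subset> V \<and> V \<subset> W}"
  define P where "P = (\<lambda>V. (excess \<tau> V - excess \<tau> U, s V - s U)) ` S
     \<union> {(1 - \<tau> i, - 1 / Di), (\<tau> j, - 1 / Dj)}"
  have "finite P"
    unfolding P_def s_def using finite_excess_values by (intro finite_UnI) auto
  moreover have "fst p > 0" if "p \<in> P" for p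
  proof -
    have "excess \<tau> V > excess \<tau> U" if "V \<in> S" for V
    proof -
      have "excess \<tau> U \<le> excess \<tau> V" using that feas by (auto simp: S_def feasible_def)
      moreover have "excess \<tau> V \<noteq> excess \<tau> U" using that nocrit by (auto simp: S_def critical_def)
      ultimately show ?thesis by simp
    qed
    then show ?thesis using that ti tj by (auto simp: P_def)
  qed
  moreover have "\<exists>p\<in>P. snd p < 0" using D by (auto simp: P_def)
  ultimately obtain t where t: "t > 0" "\<forall>p\<in>P. 0 \<le> fst p + t * snd p" "\<exists>p\<in>P. fst p + t * snd p = 0"
    using first_tight_time by blast
  have ti': "t / Di \<le> 1 - \<tau> i" and tj': "t / Dj \<le> \<tau> j"
    using t(2) by (auto simp: P_def)
  have tpos: "t / Di > 0" "t / Dj > 0" using t(1) D by auto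
  have adm': "admissible (\<sigma> t)"
    unfolding admissible_def
  proof
    fix k assume "k \<in> {1..N}"
    then have "0 \<le> \<tau> k \<and> \<tau> k \<le> 1" using adm by (simp add: admissible_def)
    then show "0 \<le> \<sigma> t k \<and> \<sigma> t k \<le> 1" using ti' tj' ti tj ij tpos by (auto simp: \<sigma>)
  qed
  have feas': "feasible (\<sigma> t) U W"
    unfolding feasible_def
  proof (intro conjI allI impI)
    show "excess (\<sigma> t) W = excess (\<sigma> t) U" using feas sW by (simp add: exc feasible_def)
    fix V assume V: "subspace V \<and> U \<subseteq> V \<and> V \<subseteq> W"
    show "excess (\<sigma> t) U \<le> excess (\<sigma> t) V"
    proof (cases "V = U \<or> V = W")
      case True
      then show ?thesis using \<open>excess (\<sigma> t) W = excess (\<sigma> t) U\<close> by auto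
    next
      case False
      then have "V \<in> S" using V by (auto simp: S_def)
      then have "0 \<le> excess \<tau> V - excess \<tau> U + t * (s V - s U)"
        using t(2) by (force simp: P_def)
      then show ?thesis by (simp add: exc algebra_simps)
    qed
  qed
  have "(\<exists>V. critical (\<sigma> t) U W V) \<or> \<sigma> t i = 1 \<or> \<sigma> t j = 0"
  proof -
    obtain p where p: "p \<in> P" "fst p + t * snd p = 0" using t(3) by auto
    then consider V where "V \<in> S" "p = (excess \<tau> V - excess \<tau> U, s V - s U)"
      | "p = (1 - \<tau> i, - 1 / Di)" | "p = (\<tau> j, - 1 / Dj)" by (auto simp: P_def)
    then show ?thesis
    proof cases
      case 1
      then have "excess (\<sigma> t) V = excess (\<sigma> t) U" using p by (simp add: exc algebra_simps)
      then show ?thesis using 1 by (auto simp: S_def critical_def)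
    next
      case 2
      then show ?thesis using p ij by (auto simp: \<sigma>)
    next
      case 3
      then show ?thesis using p ij by (auto simp: \<sigma>)
    qed
  qed
  moreover have "card {k\<in>{1..N}. 0 < \<sigma> t k \<and> \<sigma> t k < 1} < card {k\<in>{1..N}. 0 < \<tau> k \<and> \<tau> k < 1}"
    if "\<sigma> t i = 1 \<or> \<sigma> t j = 0"
  proof (rule psubset_card_mono)
    have "\<sigma> t k = \<tau> k" if "k \<noteq> i" "k \<noteq> j" for k using that by (simp add: \<sigma>)
    then have "{k\<in>{1..N}. 0 < \<sigma> t k \<and> \<sigma> t k < 1} \<subseteq> {k\<in>{1..N}. 0 < \<tau> k \<and> \<tau> k < 1}"
      using ti tj by force
    moreover have "i \<notin> {k\<in>{1..N}. 0 < \<sigma> t k \<and> \<sigma> t k < 1} \<or> j \<notin> {k\<in>{1..N}. 0 < \<sigma> t k \<and> \<sigma> t k < 1}"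
      using that by auto
    ultimately show "{k\<in>{1..N}. 0 < \<sigma> t k \<and> \<sigma> t k < 1} \<subset> {k\<in>{1..N}. 0 < \<tau> k \<and> \<tau> k < 1}"
      using ti tj ij by blast
  qed simp
  ultimately show ?thesis using t(1) adm' feas' unfolding \<sigma>_def by blast
qed

text \<open>
  The common skeleton of both constructions from feasible exponents. Unless \<open>W / U\<close> is a line, either
  a critical subspace splits the interval, or the exponents lie inside a segment of feasible exponents
  whose ends have a critical subspace or fewer fractional entries. The induction is
  lexicographic, on the dimension of \<open>W / U\<close> and the number of fractional exponents.
\<close>

theorem feasible_induct [consumes 5, case_names line glue convex]:
  assumes "subspace U" "subspace W" "U \<subset> W" "admissible \<tau>" "feasible \<tau> U W"
    and line: "\<And>U W \<tau>. subspace U \<Longrightarrow> subspace W \<Longrightarrow> U \<subset> W \<Longrightarrow> dim W = dim U + 1 \<Longrightarrow>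
       admissible \<tau> \<Longrightarrow> feasible \<tau> U W \<Longrightarrow> Q U W \<tau>"
    and glue: "\<And>U V W \<tau>. subspace U \<Longrightarrow> subspace V \<Longrightarrow> subspace W \<Longrightarrow> U \<subset> V \<Longrightarrow> V \<subset> W \<Longrightarrow>
       admissible \<tau> \<Longrightarrow> Q U V \<tau> \<Longrightarrow> Q V W \<tau> \<Longrightarrow> Q U W \<tau>"
    and convex: "\<And>U W \<tau> \<tau>' t. subspace U \<Longrightarrow> subspace W \<Longrightarrow> U \<subset> W \<Longrightarrow>
       admissible \<tau> \<Longrightarrow> admissible \<tau>' \<Longrightarrow> 0 < t \<Longrightarrow> t < 1 \<Longrightarrow> Q U W \<tau> \<Longrightarrow> Q U W \<tau>' \<Longrightarrow>
       Q U W (\<lambda>i. (1 - t) * \<tau> i + t * \<tau>' i)"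
  shows "Q U W \<tau>"
  using assms(1-5)
proof (induction "dim W - dim U" arbitrary: U W \<tau> rule: less_induct)
  case outer: less
  have split: "Q U W \<tau>'" if "critical \<tau>' U W V" "admissible \<tau>'" "feasible \<tau>' U W" for V \<tau>'
  proof -
    have V: "subspace V" "U \<subset> V" "V \<subset> W" using that by (auto simp: critical_def)
    have "dim U < dim V" "dim V < dim W" using V outer.prems by (auto intro: dim_psubset_subspace)
    then have "Q U V \<tau>'" "Q V W \<tau>'"
      using feasible_split[OF that(3,1)] V outer.prems that by (auto intro!: outer.hyps)
    then show ?thesis using glue V outer.prems that by blast
  qed
  show ?case using outer.prems
  proof (induction "card {k\<in>{1..N}. 0 < \<tau> k \<and> \<tau> k < 1}" arbitrary: \<tau> rule: less_induct)
    case inner: less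
    note prems = inner.prems
    have "dim U < dim W" using prems by (auto intro: dim_psubset_subspace)
    consider (line) "dim W = dim U + 1" | (critical) V where "critical \<tau> U W V"
      | (segment) "dim W \<ge> dim U + 2" "\<nexists>V. critical \<tau> U W V"
      using \<open>dim U < dim W\<close> by force
    then show ?case
    proof cases
      case line
      then show ?thesis using assms(6) prems by blast
    next
      case critical
      then show ?thesis using split prems by blast
    next
      case segment
      have sub: "U \<subseteq> W" using prems by auto
      obtain i j where ij: "i \<in> {1..N}" "j \<in> {1..N}" "i \<noteq> j"
        and ti: "0 < \<tau> i" "\<tau> i < 1" "dim (join i U) < dim (join i W)"
        and tj: "0 < \<tau> j" "\<tau> j < 1" "dim (join j U) < dim (join j W)"
        using two_fractional_exponents[OF prems(1,2) sub segment(1) prems(4,5) segment(2)] by metis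
      obtain s where s: "s > 0" "admissible (shift U W i j \<tau> s)" "Q U W (shift U W i j \<tau> s)"
        using shift_until_tight[OF prems(1,2) sub prems(4,5) segment(2) ij ti tj]
          split inner.hyps prems(1-3) by meson
      obtain t where t: "t > 0" "admissible (shift U W j i \<tau> t)" "Q U W (shift U W j i \<tau> t)"
        using shift_until_tight[OF prems(1,2) sub prems(4,5) segment(2) ij(2,1) ij(3)[symmetric] tj ti]
          split inner.hyps prems(1-3) by meson
      \<comment> \<open>the weight at which the two opposite shifts cancel\<close>
      define u where "u = s / (s + t)"
      have u: "0 < u" "u < 1" using s(1) t(1) by (auto simp: u_def)
      have "(1 - u) * s = u * t" using s(1) t(1) by (simp add: u_def field_simps)
      then have cancel: "(1 - u) * (s / d) = u * (t / d)" for d by (metis times_divide_eq_right)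
      have "(1 - u) * (x + s / d) + u * (x - t / d) = x" "(1 - u) * (x - s / d) + u * (x + t / d) = x"
        for x d using cancel[of d] by (simp_all only: distrib_left right_diff_distrib) (simp_all add: algebra_simps)
      moreover have "(1 - u) * x + u * x = x" for x :: real by (simp add: algebra_simps)
      ultimately have "\<tau> = (\<lambda>k. (1 - u) * shift U W i j \<tau> s k + u * shift U W j i \<tau> t k)"
        unfolding shift_def using ij(3) by (auto simp: fun_eq_iff)
      moreover have "Q U W (\<lambda>k. (1 - u) * shift U W i j \<tau> s k + u * shift U W j i \<tau> t k)"
        using convex prems(1-3) s t u by blast
      ultimately show ?thesis by simp
    qed
  qed
qed

end

section \<open>Balanced weights on graphs of subspaces\<close>

lemma insert_Un_chain: "A \<subseteq> insert u B \<Longrightarrow> A' \<subseteq> insert v B' \<Longrightarrow> v \<in> B \<Longrightarrow> A \<union> A' \<subseteq> insert u (B \<union> B')"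
  by blast

lemma insert_Un_mono: "A \<subseteq> insert u B \<Longrightarrow> A' \<subseteq> insert u B' \<Longrightarrow> A \<union> A' \<subseteq> insert u (B \<union> B')"
  by blast

text \<open>
  Requiring the divergence to vanish away from source and sink, and prescribing it there,
  expresses balance and total mass by linear equations. Superposing flows on different graphs then
  needs no case distinction about which vertices are interior.
\<close>

definition divergence :: "('v \<times> 'v) set \<Rightarrow> ('v \<times> 'v \<Rightarrow> real) \<Rightarrow> 'v \<Rightarrow> real" where
  "divergence E \<phi> V = (\<Sum>e\<in>{e\<in>E. fst e = V}. \<phi> e) - (\<Sum>e\<in>{e\<in>E. snd e = V}. \<phi> e)"

definition flow :: "('v \<times> 'v) set \<Rightarrow> ('v \<times> 'v \<Rightarrow> real) \<Rightarrow> 'v \<Rightarrow> 'v \<Rightarrow> real \<Rightarrow> bool" where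
  "flow E \<phi> U W m \<longleftrightarrow> (\<forall>V. divergence E \<phi> V = m * (of_bool (V = U) - of_bool (V = W)))"

lemma divergence_linear:
  assumes fin: "finite E" "finite E'" and supp: "\<And>e. e \<notin> E \<Longrightarrow> \<phi> e = 0" "\<And>e. e \<notin> E' \<Longrightarrow> \<psi> e = 0"
  shows "divergence (E \<union> E') (\<lambda>e. a * \<phi> e + b * \<psi> e) V = a * divergence E \<phi> V + b * divergence E' \<psi> V"
proof -
  have "sum \<phi> {e \<in> E \<union> E'. P e} = sum \<phi> {e \<in> E. P e}" "sum \<psi> {e \<in> E \<union> E'. P e} = sum \<psi> {e \<in> E'. P e}" for P
    using assms by (auto intro!: sum.mono_neutral_right)
  then show ?thesis
    by (simp add: divergence_def sum.distrib algebra_simps flip: sum_distrib_left)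
qed

lemma flow_convex:
  assumes "finite E" "finite E'" "\<And>e. e \<notin> E \<Longrightarrow> \<phi> e = 0" "\<And>e. e \<notin> E' \<Longrightarrow> \<psi> e = 0"
    and "flow E \<phi> U W m" "flow E' \<psi> U W n"
  shows "flow (E \<union> E') (\<lambda>e. a * \<phi> e + b * \<psi> e) U W (a * m + b * n)"
  unfolding flow_def
proof
  show "divergence (E \<union> E') (\<lambda>e. a * \<phi> e + b * \<psi> e) V
      = (a * m + b * n) * (of_bool (V = U) - of_bool (V = W))" for V
    using divergence_linear[of E E' \<phi> \<psi> a b V] assms by (simp add: flow_def distrib_right mult.assoc)
qed

context subspace_arrangement
begin

definition summary :: "(nat \<Rightarrow> 'a set \<times> 'a set \<Rightarrow> real) \<Rightarrow> 'a set \<times> 'a set \<Rightarrow> real" where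
  "summary \<theta> e = (\<Sum>i=1..N. \<theta> i e * of_bool (join i (fst e) \<noteq> join i (snd e)))"

text \<open>
  A valid presentation for the quotient \<open>W / U\<close>. The weights vanish outside the edge set, so that
  those of different graphs can be added. The four conditions on the ends of edges say that
  \<open>U\<close> and \<open>W\<close> are vertices and every other vertex has edges on both sides.
\<close>

definition presentation ::
  "'a set \<Rightarrow> 'a set \<Rightarrow> (nat \<Rightarrow> real) \<Rightarrow> ('a set \<times> 'a set) set \<Rightarrow> (nat \<Rightarrow> 'a set \<times> 'a set \<Rightarrow> real) \<Rightarrow> bool" where
  "presentation U W \<tau> E \<theta> \<longleftrightarrow> finite E \<and>
     (\<forall>(V1, V2)\<in>E. subspace V1 \<and> subspace V2 \<and> U \<subseteq> V1 \<and> V1 \<subset> V2 \<and> V2 \<subseteq> W \<and> dim V2 = dim V1 + 1) \<and>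
     U \<in> fst ` E \<and> W \<in> snd ` E \<and> fst ` E \<subseteq> insert U (snd ` E) \<and> snd ` E \<subseteq> insert W (fst ` E) \<and>
     (\<forall>i\<in>{1..N}. (\<forall>e. 0 \<le> \<theta> i e \<and> (e \<notin> E \<longrightarrow> \<theta> i e = 0)) \<and> flow E (\<theta> i) U W (\<tau> i)) \<and>
     flow E (summary \<theta>) U W 1"

lemma summary_linear:
  "summary (\<lambda>i e. a * \<theta> i e + b * \<theta>' i e) = (\<lambda>e. a * summary \<theta> e + b * summary \<theta>' e)"
  unfolding summary_def fun_eq_iff sum_distrib_left sum.distrib[symmetric]
  by (intro allI sum.cong) (auto simp: algebra_simps)

lemma presentationI:
  assumes "finite E"
    and "\<And>V1 V2. (V1, V2) \<in> E \<Longrightarrow>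
      subspace V1 \<and> subspace V2 \<and> U \<subseteq> V1 \<and> V1 \<subset> V2 \<and> V2 \<subseteq> W \<and> dim V2 = dim V1 + 1"
    and "U \<in> fst ` E" "W \<in> snd ` E" "fst ` E \<subseteq> insert U (snd ` E)" "snd ` E \<subseteq> insert W (fst ` E)"
    and "\<And>i e. i \<in> {1..N} \<Longrightarrow> 0 \<le> \<theta> i e" "\<And>i e. i \<in> {1..N} \<Longrightarrow> e \<notin> E \<Longrightarrow> \<theta> i e = 0"
    and "\<And>i. i \<in> {1..N} \<Longrightarrow> flow E (\<theta> i) U W (\<tau> i)" "flow E (summary \<theta>) U W 1"
  shows "presentation U W \<tau> E \<theta>"
  unfolding presentation_def
  by (intro conjI ballI case_prodI2 allI impI) (simp_all only: assms not_False_eq_True)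

lemma presentation_finite: "presentation U W \<tau> E \<theta> \<Longrightarrow> finite E"
  by (simp add: presentation_def)

lemma presentation_edge:
  assumes "presentation U W \<tau> E \<theta>" "(V1, V2) \<in> E"
  shows "subspace V1 \<and> subspace V2 \<and> U \<subseteq> V1 \<and> V1 \<subset> V2 \<and> V2 \<subseteq> W \<and> dim V2 = dim V1 + 1"
proof -
  have "case (V1, V2) of (V1, V2) \<Rightarrow>
      subspace V1 \<and> subspace V2 \<and> U \<subseteq> V1 \<and> V1 \<subset> V2 \<and> V2 \<subseteq> W \<and> dim V2 = dim V1 + 1"
    using assms unfolding presentation_def by (elim conjE) (rule bspec)
  then show ?thesis by simp
qed

lemma presentation_ends:
  assumes "presentation U W \<tau> E \<theta>"
  shows "U \<in> fst ` E" "W \<in> snd ` E" "fst ` E \<subseteq> insert U (snd ` E)" "snd ` E \<subseteq> insert W (fst ` E)"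
  using assms by (simp_all only: presentation_def simp_thms)

lemma presentation_support: "presentation U W \<tau> E \<theta> \<Longrightarrow> i \<in> {1..N} \<Longrightarrow> e \<notin> E \<Longrightarrow> \<theta> i e = 0"
  unfolding presentation_def by blast

lemma presentation_nonneg: "presentation U W \<tau> E \<theta> \<Longrightarrow> i \<in> {1..N} \<Longrightarrow> 0 \<le> \<theta> i e"
  unfolding presentation_def by blast

lemma presentation_divergence:
  "presentation U W \<tau> E \<theta> \<Longrightarrow> i \<in> {1..N} \<Longrightarrow>
     divergence E (\<theta> i) V = \<tau> i * (of_bool (V = U) - of_bool (V = W))"
  by (simp add: presentation_def flow_def)

lemma presentation_summary_divergence:
  "presentation U W \<tau> E \<theta> \<Longrightarrow>
     divergence E (summary \<theta>) V = of_bool (V = U) - of_bool (V = W)"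
  by (simp add: presentation_def flow_def)

lemma summary_support: "presentation U W \<tau> E \<theta> \<Longrightarrow> e \<notin> E \<Longrightarrow> summary \<theta> e = 0"
  unfolding summary_def by (intro sum.neutral ballI) (metis presentation_support mult_zero_left)

text \<open>
  On a line the graph has one edge, which carries all of \<open>\<tau>\<^sub>i\<close>. The rank of each map is \<open>0\<close> or \<open>1\<close>, so
  the summary weight of this edge is the sum that feasibility requires to be \<open>1\<close>.
\<close>

lemma presentation_line:
  assumes UW: "subspace U" "subspace W" "U \<subset> W" "dim W = dim U + 1"
    and adm: "admissible \<tau>" and feas: "feasible \<tau> U W"
  shows "\<exists>E \<theta>. presentation U W \<tau> E \<theta>"
proof -
  let ?E = "{(U, W)}" and ?\<theta> = "\<lambda>i e. of_bool (e = (U, W) \<and> i \<in> {1..N}) * \<tau> i"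
  have "real (dim (join i W)) - real (dim (join i U)) = of_bool (join i U \<noteq> join i W)" for i
  proof -
    obtain w where "W = span (insert w U)"
      using dim_step_span_insert[OF UW(1,2) _ UW(4)] UW(3) by auto
    moreover have "join i U \<noteq> join i W" if "dim (join i U) \<noteq> dim (join i W)" using that by auto
    moreover have "join i U = join i W" if "dim (join i U) = dim (join i W)"
      using that join_mono[of U W i] UW(3) by (intro subspace_eqI_dim) auto
    ultimately show ?thesis using join_dim_insert[of i w U] by (auto split: if_splits)
  qed
  then have "(\<Sum>i=1..N. \<tau> i * of_bool (join i U \<noteq> join i W)) = 1"
    using feas excess_diff[of \<tau> W U] UW(4) by (simp add: feasible_def)
  moreover have "summary ?\<theta> (U, W) = (\<Sum>i=1..N. \<tau> i * of_bool (join i U \<noteq> join i W))"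
    unfolding summary_def by (intro sum.cong refl) simp
  ultimately have "summary ?\<theta> (U, W) = 1" by simp
  moreover have "{e \<in> {(U, W)}. fst e = V} = (if V = U then {(U, W)} else {})"
    "{e \<in> {(U, W)}. snd e = V} = (if V = W then {(U, W)} else {})" for V by auto
  ultimately have "presentation U W \<tau> ?E ?\<theta>"
    using UW adm by (auto simp: presentation_def flow_def divergence_def admissible_def)
  then show ?thesis by blast
qed

text \<open>
  At the intermediate vertex \<open>V\<close> the sink of the first flow cancels the source of the second.
\<close>

lemma presentation_glue:
  assumes E: "presentation U V \<tau> E \<theta>" and E': "presentation V W \<tau> E' \<theta>'" and UVW: "U \<subset> V" "V \<subset> W"
  shows "presentation U W \<tau> (E \<union> E') (\<lambda>i e. \<theta> i e + \<theta>' i e)"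
proof -
  note fin = presentation_finite[OF E] presentation_finite[OF E']
  note ends = presentation_ends[OF E] presentation_ends[OF E']
  have lin: "divergence (E \<union> E') (\<lambda>e. \<phi> e + \<psi> e) X = divergence E \<phi> X + divergence E' \<psi> X"
    if "\<And>e. e \<notin> E \<Longrightarrow> \<phi> e = 0" "\<And>e. e \<notin> E' \<Longrightarrow> \<psi> e = 0" for \<phi> \<psi> X
    using divergence_linear[of E E' \<phi> \<psi> 1 1 X] fin that by simp
  have fl: "flow (E \<union> E') (\<lambda>e. \<theta> i e + \<theta>' i e) U W (\<tau> i)" if "i \<in> {1..N}" for i
    unfolding flow_def
    using presentation_divergence[OF E that] presentation_divergence[OF E' that]
      lin[OF presentation_support[OF E that] presentation_support[OF E' that]]
    by (simp add: algebra_simps)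
  have "summary (\<lambda>i e. \<theta> i e + \<theta>' i e) = (\<lambda>e. summary \<theta> e + summary \<theta>' e)"
    using summary_linear[of 1 \<theta> 1 \<theta>'] by simp
  then have sfl: "flow (E \<union> E') (summary (\<lambda>i e. \<theta> i e + \<theta>' i e)) U W 1"
    unfolding flow_def
    using presentation_summary_divergence[OF E] presentation_summary_divergence[OF E']
      lin[OF summary_support[OF E] summary_support[OF E']] by simp
  have edge: "subspace V1 \<and> subspace V2 \<and> U \<subseteq> V1 \<and> V1 \<subset> V2 \<and> V2 \<subseteq> W \<and> dim V2 = dim V1 + 1"
    if "(V1, V2) \<in> E \<union> E'" for V1 V2
    using that
  proof
    assume "(V1, V2) \<in> E"
    then show ?thesis using presentation_edge[OF E, of V1 V2] UVW by auto
  next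
    assume "(V1, V2) \<in> E'"
    then show ?thesis using presentation_edge[OF E', of V1 V2] UVW by auto
  qed
  have "snd ` E' \<union> snd ` E \<subseteq> insert W (fst ` E' \<union> fst ` E)"
    by (rule insert_Un_chain[OF ends(8,4,5)])
  then have e1: "snd ` (E \<union> E') \<subseteq> insert W (fst ` (E \<union> E'))" by (simp only: image_Un Un_commute)
  have e2: "fst ` (E \<union> E') \<subseteq> insert U (snd ` (E \<union> E'))"
    unfolding image_Un by (rule insert_Un_chain[OF ends(3,7,2)])
  have e3: "U \<in> fst ` (E \<union> E')" "W \<in> snd ` (E \<union> E')" using ends(1,6) unfolding image_Un by simp_all
  show ?thesis
  proof (rule presentationI)
    show "0 \<le> \<theta> i e + \<theta>' i e" if "i \<in> {1..N}" for i e
      using presentation_nonneg[OF E that, of e] presentation_nonneg[OF E' that, of e] by simp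
    show "\<theta> i e + \<theta>' i e = 0" if "i \<in> {1..N}" "e \<notin> E \<union> E'" for i e
      using presentation_support[OF E that(1), of e] presentation_support[OF E' that(1), of e] that(2) by simp
  qed (fact finite_UnI[OF fin] edge e1 e2 e3 fl sfl)+
qed

lemma presentation_convex:
  assumes E: "presentation U W \<tau> E \<theta>" and E': "presentation U W \<tau>' E' \<theta>'" and t: "0 < t" "t < 1"
  shows "presentation U W (\<lambda>i. (1 - t) * \<tau> i + t * \<tau>' i) (E \<union> E') (\<lambda>i e. (1 - t) * \<theta> i e + t * \<theta>' i e)"
proof -
  note fin = presentation_finite[OF E] presentation_finite[OF E']
  have D: "flow E (\<theta> i) U W (\<tau> i)" "flow E' (\<theta>' i) U W (\<tau>' i)" if "i \<in> {1..N}" for i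
    using presentation_divergence[OF E that] presentation_divergence[OF E' that] by (simp_all add: flow_def)
  have D': "flow E (summary \<theta>) U W 1" "flow E' (summary \<theta>') U W 1"
    using presentation_summary_divergence[OF E] presentation_summary_divergence[OF E'] by (simp_all add: flow_def)
  note ends = presentation_ends[OF E] presentation_ends[OF E']
  have fl: "flow (E \<union> E') (\<lambda>e. (1 - t) * \<theta> i e + t * \<theta>' i e) U W ((1 - t) * \<tau> i + t * \<tau>' i)" if "i \<in> {1..N}" for i
    using flow_convex[OF fin, where \<phi> = "\<theta> i" and \<psi> = "\<theta>' i" and a = "1 - t" and b = t]
      presentation_support[OF E that] presentation_support[OF E' that] D that by blast
  have edge: "subspace V1 \<and> subspace V2 \<and> U \<subseteq> V1 \<and> V1 \<subset> V2 \<and> V2 \<subseteq> W \<and> dim V2 = dim V1 + 1"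
    if "(V1, V2) \<in> E \<union> E'" for V1 V2
    using that
  proof
    assume "(V1, V2) \<in> E"
    then show ?thesis by (rule presentation_edge[OF E])
  next
    assume "(V1, V2) \<in> E'"
    then show ?thesis by (rule presentation_edge[OF E'])
  qed
  have sfl: "flow (E \<union> E') (summary (\<lambda>i e. (1 - t) * \<theta> i e + t * \<theta>' i e)) U W 1"
    using flow_convex[where \<phi> = "summary \<theta>" and \<psi> = "summary \<theta>'" and a = "1 - t" and b = t,
        OF fin summary_support[OF E] summary_support[OF E'] D'] by (simp add: summary_linear)
  have e1: "snd ` (E \<union> E') \<subseteq> insert W (fst ` (E \<union> E'))"
    unfolding image_Un by (rule insert_Un_mono[OF ends(4,8)])
  have e2: "fst ` (E \<union> E') \<subseteq> insert U (snd ` (E \<union> E'))"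
    unfolding image_Un by (rule insert_Un_mono[OF ends(3,7)])
  have e3: "U \<in> fst ` (E \<union> E')" "W \<in> snd ` (E \<union> E')" using ends(1,2) unfolding image_Un by simp_all
  show ?thesis
  proof (rule presentationI)
    show "0 \<le> (1 - t) * \<theta> i e + t * \<theta>' i e" if "i \<in> {1..N}" for i e
      using presentation_nonneg[OF E that, of e] presentation_nonneg[OF E' that, of e] t by simp
    show "(1 - t) * \<theta> i e + t * \<theta>' i e = 0" if "i \<in> {1..N}" "e \<notin> E \<union> E'" for i e
      using presentation_support[OF E that(1), of e] presentation_support[OF E' that(1), of e] that(2) by simp
  qed (fact finite_UnI[OF fin] edge e1 e2 e3 fl sfl)+
qed

theorem feasible_imp_presentation:
  assumes "subspace U" "subspace W" "U \<subset> W" "admissible \<tau>" "feasible \<tau> U W"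
  shows "\<exists>E \<theta>. presentation U W \<tau> E \<theta>"
  using assms
proof (induction rule: feasible_induct)
  case line then show ?case by (rule presentation_line)
next
  case (glue U V W \<tau>)
  then obtain E \<theta> E' \<theta>' where P: "presentation U V \<tau> E \<theta>" "presentation V W \<tau> E' \<theta>'" by blast
  show ?case by (rule exI, rule exI, rule presentation_glue[OF P glue.hyps(4,5)])
next
  case (convex U W \<tau> \<tau>' t)
  then obtain E \<theta> E' \<theta>' where P: "presentation U W \<tau> E \<theta>" "presentation U W \<tau>' E' \<theta>'" by blast
  show ?case by (rule exI, rule exI, rule presentation_convex[OF P convex.hyps(6,7)])
qed

text \<open>
  This and the next two lemmas translate the images \<open>\<pi>\<^sub>i(V)\<close> of the informal statement into the
  subspaces \<open>V + K i\<close>.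
\<close>

lemma join_eq_vimage:
  assumes f: "linear f" and K: "K i = {x. f x = 0}" and V: "subspace V"
  shows "join i V = f -` f ` V"
proof -
  have "subspace (K i)" unfolding K by (rule linear_subspace_kernel[OF f])
  then have "join i V = {x + y |x y. x \<in> V \<and> y \<in> K i}"
    using V by (simp add: join_def span_Un span_eq_iff[THEN iffD2])
  also have "\<dots> = f -` f ` V"
  proof safe
    fix x y assume "x \<in> V" "y \<in> K i"
    then show "x + y \<in> f -` f ` V" by (auto simp: K linear_add[OF f])
  next
    fix z x assume "f z = f x" "x \<in> V"
    then have "z = x + (z - x) \<and> x \<in> V \<and> z - x \<in> K i" by (simp add: K linear_diff[OF f])
    then show "\<exists>x y. z = x + y \<and> x \<in> V \<and> y \<in> K i" by blast
  qed
  finally show ?thesis .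
qed

lemma image_eq_iff_join_eq:
  assumes f: "linear f" and K: "K i = {x. f x = 0}" and V: "subspace V" "subspace V'"
  shows "f ` V = f ` V' \<longleftrightarrow> join i V = join i V'"
proof -
  have "f ` (f -` f ` X) = f ` X" for X by auto
  then show ?thesis using join_eq_vimage[OF f K V(1)] join_eq_vimage[OF f K V(2)] by metis
qed

lemma summary_weight_eq_summary:
  assumes lin: "\<And>i. i \<in> {1..N} \<Longrightarrow> linear (\<pi> i)" and K: "\<And>i. i \<in> {1..N} \<Longrightarrow> K i = {x. \<pi> i x = 0}"
    and "subspace V1" "subspace V2"
  shows "summary_weight N \<pi> \<theta> (V1, V2) = summary \<theta> (V1, V2)"
proof -
  have "summary \<theta> (V1, V2) = (\<Sum>i=1..N. if \<pi> i ` V1 \<noteq> \<pi> i ` V2 then \<theta> i (V1, V2) else 0)"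
    unfolding summary_def
  proof (intro sum.cong refl)
    fix i assume "i \<in> {1..N}"
    then show "\<theta> i (V1, V2) * of_bool (join i (fst (V1, V2)) \<noteq> join i (snd (V1, V2)))
        = (if \<pi> i ` V1 \<noteq> \<pi> i ` V2 then \<theta> i (V1, V2) else 0)"
      using image_eq_iff_join_eq[OF lin K assms(3,4)] by simp
  qed
  then show ?thesis
    by (simp add: summary_weight_def sum.inter_filter[symmetric])
qed

lemma presentation_imp_valid_presentation:
  assumes lin: "\<And>i. i \<in> {1..N} \<Longrightarrow> linear (\<pi> i)" and K: "\<And>i. i \<in> {1..N} \<Longrightarrow> K i = {x. \<pi> i x = 0}"
    and P: "presentation {0} UNIV \<tau> E \<theta>"
  shows "valid_presentation \<lparr>pverts = fst ` E \<union> snd ` E, parcs = E\<rparr> \<theta> N \<pi> \<tau>"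
proof -
  let ?G = "\<lparr>pverts = fst ` E \<union> snd ` E, parcs = E\<rparr>"
  note ends = presentation_ends[OF P]
  have edge: "subspace V1 \<and> subspace V2 \<and> V1 \<subset> V2 \<and> dim V2 = dim V1 + 1" if "(V1, V2) \<in> E" for V1 V2
    using presentation_edge[OF P that] by simp
  have arcs: "in_arcs (with_proj ?G) V = {e\<in>E. snd e = V}" "out_arcs (with_proj ?G) V = {e\<in>E. fst e = V}" for V
    by (auto simp: in_arcs_def out_arcs_def)
  have G: "graph_decomposition ?G"
  proof unfold_locales
    show "subspace V" if "V \<in> pverts ?G" for V using that edge by auto
    show "{0} \<in> pverts ?G" "UNIV \<in> pverts ?G" using ends(1,2) by simp_all
    show "V1 \<subset> V2" "dim V2 = dim V1 + 1" if "(V1, V2) \<in> parcs ?G" for V1 V2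
      using edge that by auto
    show "in_arcs (with_proj ?G) V \<noteq> {}" if "V \<in> pverts ?G" "V \<noteq> {0}" for V
    proof -
      have "V \<in> snd ` E" using that ends(3,4) by auto
      then show ?thesis unfolding arcs by auto
    qed
    show "out_arcs (with_proj ?G) V \<noteq> {}" if "V \<in> pverts ?G" "V \<noteq> UNIV" for V
    proof -
      have "V \<in> fst ` E" using that ends(3,4) by auto
      then show ?thesis unfolding arcs by auto
    qed
  qed (use presentation_finite[OF P] in auto)
  have no_in: "{e \<in> E. snd e = {0}} = {}"
  proof -
    have "0 \<in> V1" if "(V1, V2) \<in> E" for V1 V2 using edge[OF that] by (simp add: subspace_0)
    then show ?thesis using edge by fastforce
  qed
  note UNIV = zero_neq_UNIV[where 'a = 'a]
  have flow: "balanced ?G \<phi> \<and> total_mass ?G \<phi> = m" if fl: "flow E \<phi> {0} UNIV m" for \<phi> m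
  proof
    show "balanced ?G \<phi>"
      unfolding balanced_def arcs
    proof (intro ballI impI)
      fix V :: "'a set" assume "V \<noteq> {0}" "V \<noteq> UNIV"
      then have "divergence E \<phi> V = 0" using fl by (simp add: flow_def)
      then show "sum \<phi> {e \<in> E. snd e = V} = sum \<phi> {e \<in> E. fst e = V}" by (simp add: divergence_def)
    qed
    have "divergence E \<phi> {0} = m" using fl UNIV by (simp add: flow_def)
    then show "total_mass ?G \<phi> = m" unfolding total_mass_def arcs divergence_def no_in by simp
  qed
  have sw: "summary_weight N \<pi> \<theta> e = summary \<theta> e" if "e \<in> E" for e
    using summary_weight_eq_summary[OF lin K] edge that by (cases e) auto
  have "flow E (summary_weight N \<pi> \<theta>) {0} UNIV 1"
  proof -
    have "divergence E (summary_weight N \<pi> \<theta>) V = divergence E (summary \<theta>) V" for V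
      unfolding divergence_def by (intro arg_cong2[where f="(-)"] sum.cong) (auto simp: sw)
    then show ?thesis using presentation_summary_divergence[OF P] by (simp add: flow_def)
  qed
  then have "balanced ?G (summary_weight N \<pi> \<theta>) \<and> total_mass ?G (summary_weight N \<pi> \<theta>) = 1"
    by (rule flow)
  moreover have "balanced ?G (\<theta> i) \<and> total_mass ?G (\<theta> i) = \<tau> i" if "i \<in> {1..N}" for i
    using presentation_divergence[OF P that] by (intro flow) (simp add: flow_def)
  ultimately show ?thesis
    using G presentation_nonneg[OF P] unfolding valid_presentation_def by simp
qed

end

text \<open>
  Summation by parts: pairing a balanced weight with the increments of a potential \<open>h\<close> leaves only the
  two ends, since every other vertex receives as much as it emits. The choice \<open>h = 1\<close> shows that the
  mass entering the whole space is the total mass.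
\<close>

lemma balanced_potential:
  fixes \<phi> :: "'a::euclidean_space set \<times> 'a set \<Rightarrow> real" and h :: "'a set \<Rightarrow> real"
  assumes G: "graph_decomposition G" and bal: "balanced G \<phi>"
  shows "(\<Sum>e\<in>parcs G. \<phi> e * (h (snd e) - h (fst e))) = total_mass G \<phi> * (h UNIV - h {0})"
proof -
  interpret graph_decomposition G by fact
  define i where "i V = (\<Sum>e\<in>{e\<in>parcs G. snd e = V}. \<phi> e)" for V
  define o' where "o' V = (\<Sum>e\<in>{e\<in>parcs G. fst e = V}. \<phi> e)" for V
  note UNIV = zero_neq_UNIV[where 'a = 'a]
  have arcs: "in_arcs (with_proj G) V = {e\<in>parcs G. snd e = V}" "out_arcs (with_proj G) V = {e\<in>parcs G. fst e = V}" for V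
    by (auto simp: in_arcs_def out_arcs_def)
  have bal': "i V - o' V = 0" if "V \<in> pverts G - {{0}, UNIV}" for V
    using bal that unfolding balanced_def arcs i_def o'_def by auto
  have gen: "(\<Sum>e\<in>parcs G. \<phi> e * (g (snd e) - g (fst e))) = o' {0} * - g {0} + i UNIV * g UNIV" for g
  proof -
    have "(\<Sum>e\<in>parcs G. \<phi> e * g (snd e)) = (\<Sum>V\<in>pverts G. \<Sum>e\<in>{e\<in>parcs G. snd e = V}. \<phi> e * g (snd e))"
      using pair_finite_arcs pair_finite_verts by (intro sum.group[symmetric]) (auto dest: in_arcsD1 in_arcsD2)
    also have "\<dots> = (\<Sum>V\<in>pverts G. i V * g V)" by (simp add: i_def sum_distrib_right)
    finally have 1: "(\<Sum>e\<in>parcs G. \<phi> e * g (snd e)) = (\<Sum>V\<in>pverts G. i V * g V)" .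
    have "(\<Sum>e\<in>parcs G. \<phi> e * g (fst e)) = (\<Sum>V\<in>pverts G. \<Sum>e\<in>{e\<in>parcs G. fst e = V}. \<phi> e * g (fst e))"
      using pair_finite_arcs pair_finite_verts by (intro sum.group[symmetric]) (auto dest: in_arcsD1 in_arcsD2)
    also have "\<dots> = (\<Sum>V\<in>pverts G. o' V * g V)" by (simp add: o'_def sum_distrib_right)
    finally have 2: "(\<Sum>e\<in>parcs G. \<phi> e * g (fst e)) = (\<Sum>V\<in>pverts G. o' V * g V)" .
    have "(\<Sum>e\<in>parcs G. \<phi> e * (g (snd e) - g (fst e))) = (\<Sum>V\<in>pverts G. (i V - o' V) * g V)"
      by (simp add: 1 2 right_diff_distrib left_diff_distrib sum_subtractf)
    also have "\<dots> = (\<Sum>V\<in>{{0}, UNIV}. (i V - o' V) * g V)"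
      using bal' zero_vert UNIV_vert pair_finite_verts by (intro sum.mono_neutral_right) auto
    also have "\<dots> = (i {0} - o' {0}) * g {0} + (i UNIV - o' UNIV) * g UNIV"
      using UNIV by simp
    also have "i {0} = 0"
    proof -
      have "0 \<in> V" if "V \<in> pverts G" for V using verts_subspace[OF that] by (rule subspace_0)
      then have "{e\<in>parcs G. snd e = {0}} = {}" using arc_subset arc_fst_in_verts by fastforce
      then show ?thesis unfolding i_def by (simp only: sum.empty)
    qed
    also have "o' UNIV = 0"
    proof -
      have "{e\<in>parcs G. fst e = UNIV} = {}" using arc_subset by fastforce
      then show ?thesis unfolding o'_def by (simp only: sum.empty)
    qed
    finally show ?thesis by simp
  qed
  have "o' {0} = i UNIV" using gen[of "\<lambda>_. 1"] by simp
  moreover have "total_mass G \<phi> = o' {0}" by (simp add: total_mass_def arcs o'_def)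
  ultimately show ?thesis using gen[of h] by (simp add: algebra_simps)
qed

text \<open>
  Pair the summary weight with the potential \<open>dim (X \<inter> V)\<close> and each \<open>\<theta>\<^sub>i\<close> with the potential
  \<open>dim ((X + K i) \<inter> (V + K i))\<close>. The first pairing gives \<open>dim X\<close>, the others add up to
  \<open>\<Sum>\<^sub>i \<tau>\<^sub>i dim \<pi>\<^sub>i(X)\<close>. Along an edge that counts for \<open>\<sigma>\<close>, a vector of \<open>X\<close> that is new in the larger
  vertex stays new after adding \<open>K i\<close>; so the comparison holds edge by edge. For \<open>X = H\<close> it is an
  equality on every edge.
\<close>

lemma (in subspace_arrangement) valid_presentation_imp_feasible:
  assumes lin: "\<And>i. i \<in> {1..N} \<Longrightarrow> linear (\<pi> i)" and K: "\<And>i. i \<in> {1..N} \<Longrightarrow> K i = {x. \<pi> i x = 0}"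
    and val: "valid_presentation G \<theta> N \<pi> \<tau>"
  shows "feasible \<tau> {0} UNIV"
proof -
  have G: "graph_decomposition G" using val by (simp add: valid_presentation_def)
  interpret graph_decomposition G by fact
  define \<sigma> where "\<sigma> = summary_weight N \<pi> \<theta>"
  have \<theta>: "\<And>e. e \<in> parcs G \<Longrightarrow> 0 \<le> \<theta> i e" "balanced G (\<theta> i)" "total_mass G (\<theta> i) = \<tau> i" if "i \<in> {1..N}" for i
    using val that by (auto simp: valid_presentation_def)
  have bal\<sigma>: "balanced G \<sigma>" "total_mass G \<sigma> = 1" using val by (auto simp: valid_presentation_def \<sigma>_def)
  have edge: "subspace (fst e)" "subspace (snd e)" "fst e \<subset> snd e" "dim (snd e) = dim (fst e) + 1"
    if "e \<in> parcs G" for e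
    using that verts_subspace arc_fst_in_verts arc_snd_in_verts arc_subset[of "fst e" "snd e"] arc_dim[of "fst e" "snd e"]
    by auto
  have \<sigma>: "\<sigma> e = (\<Sum>i=1..N. \<theta> i e * of_bool (join i (fst e) \<noteq> join i (snd e)))" if "e \<in> parcs G" for e
    using summary_weight_eq_summary[OF lin K edge(1,2)[OF that], of \<theta>]
    by (simp add: \<sigma>_def summary_def)
  have swap: "(\<Sum>e\<in>parcs G. \<sigma> e * d e)
      = (\<Sum>i=1..N. \<Sum>e\<in>parcs G. \<theta> i e * (of_bool (join i (fst e) \<noteq> join i (snd e)) * d e))" for d :: "_ \<Rightarrow> real"
  proof -
    have "(\<Sum>e\<in>parcs G. \<sigma> e * d e) = (\<Sum>e\<in>parcs G. \<Sum>i=1..N. \<theta> i e * (of_bool (join i (fst e) \<noteq> join i (snd e)) * d e))"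
      by (intro sum.cong) (simp_all only: \<sigma> sum_distrib_right mult.assoc)
    then show ?thesis by (simp only: sum.swap[of _ "{1..N}"])
  qed
  have join_zero: "join i {0} = span (K i)" for i by (simp add: join_def)
  have join_UNIV: "join i UNIV = UNIV" for i using subset_join[of UNIV i] by auto
  have le: "excess \<tau> {0} \<le> excess \<tau> X" if X: "subspace X" for X
  proof -
    have "real (dim X) = (\<Sum>e\<in>parcs G. \<sigma> e * (real (dim (X \<inter> snd e)) - real (dim (X \<inter> fst e))))"
      using balanced_potential[OF G bal\<sigma>(1), of "\<lambda>V. real (dim (X \<inter> V))"] bal\<sigma>(2) subspace_0[OF X] by simp
    also have "\<dots> = (\<Sum>i=1..N. \<Sum>e\<in>parcs G. \<theta> i e *
        (of_bool (join i (fst e) \<noteq> join i (snd e)) * (real (dim (X \<inter> snd e)) - real (dim (X \<inter> fst e)))))"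
      by (rule swap)
    also have "\<dots> \<le> (\<Sum>i=1..N. \<Sum>e\<in>parcs G. \<theta> i e *
        (real (dim (join i X \<inter> join i (snd e))) - real (dim (join i X \<inter> join i (fst e)))))"
    proof (intro sum_mono mult_left_mono)
      fix i e assume i: "i \<in> {1..N}" and e: "e \<in> parcs G"
      show "0 \<le> \<theta> i e" using \<theta> i e by auto
      have sub: "fst e \<subseteq> snd e" using edge(3)[OF e] by auto
      let ?L = "join i X \<inter> join i (fst e)" and ?R = "join i X \<inter> join i (snd e)"
      have LR: "subspace ?L" "subspace ?R" "?L \<subseteq> ?R" using join_mono[OF sub, of i] by (auto simp: subspace_inter)
      have mono: "dim ?L \<le> dim ?R" by (rule dim_subset[OF LR(3)])
      have sX: "subspace (X \<inter> fst e)" "subspace (X \<inter> snd e)" using X edge[OF e] by (auto simp: subspace_inter)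
      show "of_bool (join i (fst e) \<noteq> join i (snd e)) * (real (dim (X \<inter> snd e)) - real (dim (X \<inter> fst e)))
          \<le> real (dim ?R) - real (dim ?L)"
      proof (cases "join i (fst e) \<noteq> join i (snd e) \<and> X \<inter> snd e \<noteq> X \<inter> fst e")
        case False
        then show ?thesis using mono by auto
      next
        case True
        then obtain w where w: "w \<in> X" "w \<in> snd e" "w \<notin> fst e" using sub by auto
        have "span (insert w (fst e)) = snd e"
          using w edge[OF e] sub by (intro subspace_eqI_dim span_minimal) (auto simp: dim_insert span_eq_iff[THEN iffD2])
        then have "join i (snd e) = span (insert w (join i (fst e)))" using join_insert by metis
        then have "w \<notin> join i (fst e)" using True by (auto simp: span_redundant span_eq_iff[THEN iffD2] insert_absorb)
        moreover have "w \<in> ?R" using w subset_join by blast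
        ultimately have "?L \<subset> ?R" using LR(3) by auto
        then have "dim ?L < dim ?R" using LR by (intro dim_psubset_subspace) auto
        moreover have "dim (X \<inter> snd e) \<le> dim (X \<inter> fst e) + 1"
        proof -
          have "X \<inter> snd e \<subseteq> span (insert w (X \<inter> fst e))"
          proof
            fix y assume y: "y \<in> X \<inter> snd e"
            then have "y \<in> span (insert w (fst e))" using \<open>span (insert w (fst e)) = snd e\<close> by auto
            then obtain k where "y - k *\<^sub>R w \<in> fst e" using edge(1)[OF e]
              by (auto simp: span_breakdown_eq span_eq_iff[THEN iffD2])
            moreover have "y - k *\<^sub>R w \<in> X" using y w X by (auto intro: subspace_diff subspace_scale)
            ultimately show "y \<in> span (insert w (X \<inter> fst e))"
              unfolding span_breakdown_eq by (auto intro: span_base)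
          qed
          then have "dim (X \<inter> snd e) \<le> dim (insert w (X \<inter> fst e))" by (rule dim_mono)
          then show ?thesis by (auto simp: dim_insert split: if_splits)
        qed
        ultimately show ?thesis using True by simp
      qed
    qed
    also have "\<dots> = (\<Sum>i=1..N. \<tau> i * (real (dim (join i X)) - real (dim (join i {0}))))"
    proof (intro sum.cong refl)
      fix i assume i: "i \<in> {1..N}"
      have "join i X \<inter> join i {0} = join i {0}" using join_mono[of "{0}" X i] subspace_0[OF X] by auto
      then show "(\<Sum>e\<in>parcs G. \<theta> i e * (real (dim (join i X \<inter> join i (snd e))) - real (dim (join i X \<inter> join i (fst e)))))
          = \<tau> i * (real (dim (join i X)) - real (dim (join i {0})))"
        using balanced_potential[OF G \<theta>(2)[OF i], of "\<lambda>V. real (dim (join i X \<inter> join i V))"] \<theta>(3)[OF i] by (simp add: join_UNIV)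
    qed
    finally show ?thesis using excess_diff[of \<tau> X "{0}"] by simp
  qed
  moreover have "excess \<tau> UNIV = excess \<tau> {0}"
  proof -
    have "real (DIM('a)) = (\<Sum>e\<in>parcs G. \<sigma> e * (real (dim (snd e)) - real (dim (fst e))))"
      using balanced_potential[OF G bal\<sigma>(1), of "\<lambda>V. real (dim V)"] bal\<sigma>(2) by simp
    also have "\<dots> = (\<Sum>i=1..N. \<Sum>e\<in>parcs G. \<theta> i e *
        (of_bool (join i (fst e) \<noteq> join i (snd e)) * (real (dim (snd e)) - real (dim (fst e)))))"
      by (rule swap)
    also have "\<dots> = (\<Sum>i=1..N. \<Sum>e\<in>parcs G. \<theta> i e * (real (dim (join i (snd e))) - real (dim (join i (fst e)))))"
    proof (intro sum.cong refl arg_cong2[where f="(*)"])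
      fix i e assume e: "e \<in> parcs G"
      obtain w where w: "snd e = span (insert w (fst e))"
        using dim_step_span_insert[of "fst e" "snd e"] edge[OF e] by auto
      have sub: "fst e \<subseteq> snd e" using edge(3)[OF e] by auto
      have "join i (fst e) = join i (snd e) \<longleftrightarrow> dim (join i (fst e)) = dim (join i (snd e))"
        using subspace_eqI_dim[of "join i (fst e)" "join i (snd e)"] join_mono[OF sub, of i] by auto
      then show "of_bool (join i (fst e) \<noteq> join i (snd e)) * (real (dim (snd e)) - real (dim (fst e)))
          = real (dim (join i (snd e))) - real (dim (join i (fst e)))"
        using join_dim_insert[of i w "fst e"] w edge(4)[OF e] by (auto split: if_splits)
    qed
    also have "\<dots> = (\<Sum>i=1..N. \<tau> i * (real (dim (join i UNIV)) - real (dim (join i {0}))))"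
      using balanced_potential[OF G \<theta>(2), of _ "\<lambda>V. real (dim (join _ V))"] \<theta>(3) by (intro sum.cong refl) auto
    finally show ?thesis using excess_diff[of \<tau> UNIV "{0}"] by simp
  qed
  ultimately show ?thesis by (simp add: feasible_def)
qed

section \<open>Hoelder's inequality and iterated line integrals\<close>

lemma ennreal_powr_0 [simp]: "ennreal_powr x 0 = 1"
  by (simp add: ennreal_powr_def)

lemma ennreal_powr_1 [simp]: "ennreal_powr x 1 = x"
  by (cases x) (auto simp: ennreal_powr_def)

lemma ennreal_powr_ennreal: "0 \<le> x \<Longrightarrow> p \<noteq> 0 \<Longrightarrow> ennreal_powr (ennreal x) p = ennreal (x powr p)"
  by (simp add: ennreal_powr_def)

lemma ennreal_powr_top: "p \<noteq> 0 \<Longrightarrow> ennreal_powr top p = top"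
  by (simp add: ennreal_powr_def)

lemma ennreal_powr_zero: "p \<noteq> 0 \<Longrightarrow> ennreal_powr 0 p = 0"
  by (simp add: ennreal_powr_def)

lemma ennreal_powr_eq_0_iff: "ennreal_powr x p = 0 \<longleftrightarrow> x = 0 \<and> p \<noteq> 0"
  by (cases x) (auto simp: ennreal_powr_def)

lemma ennreal_powr_finite: "x < \<infinity> \<Longrightarrow> ennreal_powr x p < \<infinity>"
  by (simp add: ennreal_powr_def)

lemma measurable_ennreal_powr [measurable]: "(\<lambda>x. ennreal_powr x p) \<in> borel_measurable borel"
  unfolding ennreal_powr_def by measurable

lemma ennreal_powr_mono: "0 \<le> p \<Longrightarrow> x \<le> y \<Longrightarrow> ennreal_powr x p \<le> ennreal_powr y p"
  by (cases x; cases y) (auto simp: ennreal_powr_def powr_mono2 ennreal_leI top_unique)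

text \<open>
  The convention that the power \<open>0\<close> of anything is \<open>1\<close> is what makes the laws of exponents hold for
  all nonnegative exponents, with \<open>0\<close> and \<open>\<infinity>\<close> among the bases.
\<close>

lemma ennreal_powr_mult: "0 \<le> p \<Longrightarrow> ennreal_powr (x * y) p = ennreal_powr x p * ennreal_powr y p"
proof (cases "p = 0")
  case False
  then show ?thesis
    by (cases x; cases y)
      (auto simp: ennreal_powr_top ennreal_powr_ennreal ennreal_powr_zero powr_mult
        ennreal_mult'[symmetric] ennreal_mult_top ennreal_top_mult ennreal_powr_eq_0_iff)
qed simp

lemma ennreal_powr_add:
  "0 \<le> p \<Longrightarrow> 0 \<le> q \<Longrightarrow> ennreal_powr x (p + q) = ennreal_powr x p * ennreal_powr x q"
  by (cases x; cases "p = 0"; cases "q = 0")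
     (auto simp: ennreal_powr_top ennreal_powr_ennreal powr_add ennreal_mult'[symmetric] ennreal_powr_zero)

lemma ennreal_powr_powr:
  "0 \<le> p \<Longrightarrow> 0 \<le> q \<Longrightarrow> ennreal_powr (ennreal_powr x p) q = ennreal_powr x (p * q)"
  by (cases x; cases "p = 0"; cases "q = 0")
     (auto simp: ennreal_powr_top ennreal_powr_ennreal powr_powr ennreal_powr_def)

lemma ennreal_powr_one [simp]: "ennreal_powr 1 p = 1"
  by (simp add: ennreal_powr_def)

lemma ennreal_powr_prod:
  "0 \<le> p \<Longrightarrow> ennreal_powr (\<Prod>i\<in>I. f i) p = (\<Prod>i\<in>I. ennreal_powr (f i) p)"
  by (induction I rule: infinite_finite_induct) (auto simp: ennreal_powr_mult)

lemma ennreal_young: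
  assumes "0 < t" "t < 1"
  shows "ennreal_powr a (1 - t) * ennreal_powr b t \<le> ennreal (1 - t) * a + ennreal t * b"
proof -
  consider "a = 0 \<or> b = 0" | "a = top" | "b = top"
    | x y where "a = ennreal x" "b = ennreal y" "x > 0" "y > 0"
    by (cases a; cases b) (auto simp: le_less)
  then show ?thesis
  proof cases
    case 4
    have "ennreal (x powr (1 - t) * y powr t) \<le> ennreal ((1 - t) * x + t * y)"
      using Youngs_inequality_0[of "1 - t" t x y] assms 4 by (intro ennreal_leI) auto
    then show ?thesis using assms 4
      by (simp add: ennreal_powr_ennreal ennreal_mult ennreal_plus)
  qed (use assms in \<open>auto simp: ennreal_powr_zero ennreal_mult_top\<close>)
qed

text \<open>
  Once both integrals are normalised to \<open>1\<close>, this is Young's inequality integrated. The normalisation needs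
  both integrals positive and finite; otherwise one side is \<open>0\<close> or \<open>\<infinity>\<close>.
\<close>

lemma nn_integral_Holder:
  assumes [measurable]: "f \<in> borel_measurable M" "g \<in> borel_measurable M" and t: "0 < t" "t < 1"
  shows "(\<integral>\<^sup>+x. ennreal_powr (f x) (1 - t) * ennreal_powr (g x) t \<partial>M)
    \<le> ennreal_powr (\<integral>\<^sup>+x. f x \<partial>M) (1 - t) * ennreal_powr (\<integral>\<^sup>+x. g x \<partial>M) t"
proof -
  define A where "A = (\<integral>\<^sup>+x. f x \<partial>M)"
  define B where "B = (\<integral>\<^sup>+x. g x \<partial>M)"
  consider "A = 0 \<or> B = 0" | "A \<noteq> 0" "B \<noteq> 0" "A = top \<or> B = top"
    | "A \<noteq> 0" "B \<noteq> 0" "A \<noteq> top" "B \<noteq> top" by blast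
  then have "(\<integral>\<^sup>+x. ennreal_powr (f x) (1 - t) * ennreal_powr (g x) t \<partial>M)
    \<le> ennreal_powr A (1 - t) * ennreal_powr B t"
  proof cases
    case 1
    then have "(AE x in M. f x = 0) \<or> (AE x in M. g x = 0)"
      by (auto simp: A_def B_def nn_integral_0_iff_AE)
    then have "AE x in M. ennreal_powr (f x) (1 - t) * ennreal_powr (g x) t = 0"
    proof
      assume "AE x in M. f x = 0"
      then show ?thesis by eventually_elim (use t in \<open>simp add: ennreal_powr_zero\<close>)
    next
      assume "AE x in M. g x = 0"
      then show ?thesis by eventually_elim (use t in \<open>simp add: ennreal_powr_zero\<close>)
    qed
    then have "(\<integral>\<^sup>+x. ennreal_powr (f x) (1 - t) * ennreal_powr (g x) t \<partial>M) = 0"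
      by (subst nn_integral_0_iff_AE) auto
    then show ?thesis by simp
  next
    case 2
    then have "ennreal_powr A (1 - t) * ennreal_powr B t = top"
      using t by (auto simp: ennreal_powr_top ennreal_mult_eq_top_iff ennreal_powr_eq_0_iff)
    then show ?thesis by simp
  next
    case 3
    let ?f = "\<lambda>x. f x / A" and ?g = "\<lambda>x. g x / B"
    have "(\<integral>\<^sup>+x. ennreal_powr (f x) (1 - t) * ennreal_powr (g x) t \<partial>M)
      = (\<integral>\<^sup>+x. ennreal_powr A (1 - t) * ennreal_powr B t
            * (ennreal_powr (?f x) (1 - t) * ennreal_powr (?g x) t) \<partial>M)"
    proof (rule nn_integral_cong)
      fix x
      have "f x = A * ?f x" "g x = B * ?g x"
        using 3 by (metis ennreal_mult_divide_eq ennreal_times_divide mult.commute)+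
      then have "ennreal_powr (f x) (1 - t) = ennreal_powr A (1 - t) * ennreal_powr (?f x) (1 - t)"
        "ennreal_powr (g x) t = ennreal_powr B t * ennreal_powr (?g x) t"
        using t by (metis ennreal_powr_mult diff_ge_0_iff_ge less_imp_le)+
      then show "ennreal_powr (f x) (1 - t) * ennreal_powr (g x) t = ennreal_powr A (1 - t) * ennreal_powr B t
            * (ennreal_powr (?f x) (1 - t) * ennreal_powr (?g x) t)" by (simp add: mult_ac)
    qed
    also have "\<dots> = ennreal_powr A (1 - t) * ennreal_powr B t
        * (\<integral>\<^sup>+x. ennreal_powr (?f x) (1 - t) * ennreal_powr (?g x) t \<partial>M)"
      by (subst nn_integral_cmult) auto
    also have "(\<integral>\<^sup>+x. ennreal_powr (?f x) (1 - t) * ennreal_powr (?g x) t \<partial>M)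
        \<le> (\<integral>\<^sup>+x. ennreal (1 - t) * ?f x + ennreal t * ?g x \<partial>M)"
      by (intro nn_integral_mono ennreal_young t)
    also have "\<dots> = ennreal (1 - t) * (A / A) + ennreal t * (B / B)"
      by (simp add: nn_integral_add nn_integral_cmult nn_integral_divide A_def B_def)
    also have "\<dots> = 1"
      using 3 t by (simp add: ennreal_divide_self top.not_eq_extremum flip: ennreal_plus)
    finally show ?thesis by (simp add: mult_left_mono)
  qed
  then show ?thesis by (simp add: A_def B_def)
qed

text \<open>
  Hoelder's inequality with several exponents: merge all factors but one into a single function with the
  rescaled exponents \<open>p i / t\<close>.
\<close>

lemma nn_integral_Holder_prod:
  assumes "finite I" "\<And>i. i \<in> I \<Longrightarrow> f i \<in> borel_measurable M"
    and "\<And>i. i \<in> I \<Longrightarrow> 0 \<le> p i" "(\<Sum>i\<in>I. p i) = (1::real)"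
  shows "(\<integral>\<^sup>+x. (\<Prod>i\<in>I. ennreal_powr (f i x) (p i)) \<partial>M)
    \<le> (\<Prod>i\<in>I. ennreal_powr (\<integral>\<^sup>+x. f i x \<partial>M) (p i))"
  using assms
proof (induction I arbitrary: p rule: finite_induct)
  case (insert j I)
  note [measurable] = insert.prems(1)
  define t where "t = (\<Sum>i\<in>I. p i)"
  have "0 \<le> p j" "0 \<le> t" "p j + t = 1"
    using insert by (auto simp: t_def intro!: sum_nonneg)
  then have t: "p j = 1 - t" "0 \<le> t" "t \<le> 1" by auto
  consider "t = 0" | "t = 1" | "0 < t" "t < 1" using t by linarith
  then show ?case
  proof cases
    case 1
    then have "\<forall>i\<in>I. p i = 0"
      unfolding t_def using insert by (subst (asm) sum_nonneg_eq_0_iff) auto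
    then show ?thesis using insert(1,2) t 1 by simp
  next
    case 2
    then show ?thesis using insert t by (simp add: t_def)
  next
    case 3
    define g where "g x = (\<Prod>i\<in>I. ennreal_powr (f i x) (p i / t))" for x
    have g [measurable]: "g \<in> borel_measurable M" unfolding g_def by measurable
    have powr_t: "ennreal_powr (\<Prod>i\<in>I. ennreal_powr (h i) (p i / t)) t = (\<Prod>i\<in>I. ennreal_powr (h i) (p i))" for h
      using 3 insert.prems(2) by (simp add: ennreal_powr_prod ennreal_powr_powr)
    have "(\<integral>\<^sup>+x. (\<Prod>i\<in>insert j I. ennreal_powr (f i x) (p i)) \<partial>M)
      = (\<integral>\<^sup>+x. ennreal_powr (f j x) (1 - t) * ennreal_powr (g x) t \<partial>M)"
      using insert(1,2) t by (simp add: g_def powr_t)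
    also have "\<dots> \<le> ennreal_powr (\<integral>\<^sup>+x. f j x \<partial>M) (1 - t) * ennreal_powr (\<integral>\<^sup>+x. g x \<partial>M) t"
      using 3 insert.prems(1) by (intro nn_integral_Holder) auto
    also have "\<dots> \<le> ennreal_powr (\<integral>\<^sup>+x. f j x \<partial>M) (1 - t)
        * ennreal_powr (\<Prod>i\<in>I. ennreal_powr (\<integral>\<^sup>+x. f i x \<partial>M) (p i / t)) t"
    proof (intro mult_left_mono ennreal_powr_mono)
      show "(\<integral>\<^sup>+x. g x \<partial>M) \<le> (\<Prod>i\<in>I. ennreal_powr (\<integral>\<^sup>+x. f i x \<partial>M) (p i / t))"
        unfolding g_def using insert.prems 3
        by (intro insert.IH) (auto simp: t_def simp flip: sum_divide_distrib)
    qed (use t in auto)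
    also have "\<dots> = (\<Prod>i\<in>insert j I. ennreal_powr (\<integral>\<^sup>+x. f i x \<partial>M) (p i))"
      using insert(1,2) t by (simp add: powr_t)
    finally show ?thesis .
  qed
qed simp

definition line_int :: "'a::euclidean_space \<Rightarrow> ('a \<Rightarrow> ennreal) \<Rightarrow> 'a \<Rightarrow> ennreal" where
  "line_int v f x = (\<integral>\<^sup>+t. f (x + t *\<^sub>R v) \<partial>lborel)"

text \<open>
  Integration over the translates of a quotient \<open>W / U\<close> is written as integration along lines in the
  directions of a list of vectors that spans \<open>W\<close> modulo \<open>U\<close>. Concatenating such lists is
  Tonelli's theorem for the intermediate subspace.
\<close>

primrec iter_int :: "'a::euclidean_space list \<Rightarrow> ('a \<Rightarrow> ennreal) \<Rightarrow> 'a \<Rightarrow> ennreal" where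
  "iter_int [] f = f"
| "iter_int (v # vs) f = iter_int vs (line_int v f)"

primrec chain :: "'a::euclidean_space set \<Rightarrow> 'a list \<Rightarrow> 'a set \<Rightarrow> bool" where
  "chain U [] W \<longleftrightarrow> U = W"
| "chain U (v # vs) W \<longleftrightarrow> v \<notin> U \<and> chain (span (insert v U)) vs W"

definition invariant :: "'a::euclidean_space set \<Rightarrow> ('a \<Rightarrow> ennreal) \<Rightarrow> bool" where
  "invariant U f \<longleftrightarrow> (\<forall>x. \<forall>u\<in>U. f (x + u) = f x)"

lemma measurable_line_int [measurable (raw)]:
  assumes [measurable]: "f \<in> borel_measurable borel"
  shows "line_int v f \<in> borel_measurable borel"
  unfolding line_int_def[abs_def] by measurable

lemma measurable_iter_int:
  "f \<in> borel_measurable borel \<Longrightarrow> iter_int vs f \<in> borel_measurable borel"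
  by (induction vs arbitrary: f) (auto intro: measurable_line_int)

lemma line_int_mono: "(\<And>x. f x \<le> g x) \<Longrightarrow> line_int v f x \<le> line_int v g x"
  unfolding line_int_def by (intro nn_integral_mono) auto

lemma iter_int_mono: "(\<And>x. f x \<le> g x) \<Longrightarrow> iter_int vs f x \<le> iter_int vs g x"
proof (induction vs arbitrary: f g)
  case (Cons v vs)
  show ?case using Cons.IH[of "line_int v f" "line_int v g"] line_int_mono[of f g v] Cons.prems by simp
qed simp

lemma line_int_cmult:
  assumes [measurable]: "f \<in> borel_measurable borel"
  shows "line_int v (\<lambda>x. c * f x) = (\<lambda>x. c * line_int v f x)"
  unfolding line_int_def by (subst nn_integral_cmult) auto

lemma iter_int_cmult:
  "f \<in> borel_measurable borel \<Longrightarrow> iter_int vs (\<lambda>x. c * f x) = (\<lambda>x. c * iter_int vs f x)"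
  by (induction vs arbitrary: f) (auto simp: line_int_cmult measurable_line_int)

lemma iter_int_append: "iter_int (vs @ ws) f = iter_int ws (iter_int vs f)"
  by (induction vs arbitrary: f) auto

lemma line_int_commute:
  assumes [measurable]: "f \<in> borel_measurable borel"
  shows "line_int v (line_int w f) = line_int w (line_int v f)"
proof
  fix x
  have "line_int v (line_int w f) x = (\<integral>\<^sup>+t. \<integral>\<^sup>+s. f (x + t *\<^sub>R v + s *\<^sub>R w) \<partial>lborel \<partial>lborel)"
    by (simp add: line_int_def)
  also have "\<dots> = (\<integral>\<^sup>+s. \<integral>\<^sup>+t. f (x + t *\<^sub>R v + s *\<^sub>R w) \<partial>lborel \<partial>lborel)"
    by (rule lborel_pair.Fubini') measurable
  also have "\<dots> = line_int w (line_int v f) x"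
    by (simp add: line_int_def add.assoc add.commute add.left_commute)
  finally show "line_int v (line_int w f) x = line_int w (line_int v f) x" .
qed

lemma invariant_span_insert_line_int:
  assumes [measurable]: "f \<in> borel_measurable borel" and "invariant U f" "subspace U"
  shows "invariant (span (insert v U)) (line_int v f)"
  unfolding invariant_def
proof (intro allI ballI)
  fix x u assume "u \<in> span (insert v U)"
  then obtain k where k: "u - k *\<^sub>R v \<in> U" using assms(3) by (auto simp: span_breakdown_eq span_eq_iff[THEN iffD2])
  have "line_int v f (x + u) = (\<integral>\<^sup>+t. f (x + t *\<^sub>R v) \<partial>lborel)"
  proof -
    \<comment> \<open>the factor \<open>1\<close> matches the affine substitution \<open>t \<mapsto> k + 1 t\<close>\<close>
    have "f (x + u + t *\<^sub>R v) = f (x + (k + 1 * t) *\<^sub>R v)" for t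
    proof -
      have "x + u + t *\<^sub>R v = x + (k + 1 * t) *\<^sub>R v + (u - k *\<^sub>R v)" by (simp add: algebra_simps)
      then show ?thesis using assms(2) k by (metis invariant_def)
    qed
    then have "line_int v f (x + u) = (\<integral>\<^sup>+t. f (x + (k + 1 * t) *\<^sub>R v) \<partial>lborel)"
      by (simp add: line_int_def)
    also have "\<dots> = (\<integral>\<^sup>+t. f (x + t *\<^sub>R v) \<partial>lborel)"
      using nn_integral_real_affine[of "\<lambda>t. f (x + t *\<^sub>R v)" 1 k] by simp
    finally show ?thesis .
  qed
  then show "line_int v f (x + u) = line_int v f x" by (simp add: line_int_def)
qed

lemma chain_subspace: "subspace U \<Longrightarrow> chain U vs W \<Longrightarrow> subspace W \<and> U \<subseteq> W \<and> dim W = dim U + length vs"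
proof (induction vs arbitrary: U)
  case (Cons v vs)
  have "subspace W \<and> span (insert v U) \<subseteq> W \<and> dim W = dim (span (insert v U)) + length vs"
    using Cons.IH[of "span (insert v U)"] Cons.prems by simp
  moreover have "U \<subseteq> span (insert v U)" by (meson span_superset subset_insertI subset_trans)
  moreover have "dim (span (insert v U)) = dim U + 1"
    using Cons.prems by (simp add: dim_insert span_eq_iff[THEN iffD2])
  ultimately show ?case by auto
qed auto

lemma chain_append: "chain U vs V \<Longrightarrow> chain V ws W \<Longrightarrow> chain U (vs @ ws) W"
  by (induction vs arbitrary: U) auto

lemma invariant_iter_int:
  "f \<in> borel_measurable borel \<Longrightarrow> invariant U f \<Longrightarrow> subspace U \<Longrightarrow> chain U vs W \<Longrightarrow> invariant W (iter_int vs f)"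
  by (induction vs arbitrary: f U) (auto intro: measurable_line_int invariant_span_insert_line_int)

text \<open>
  Gram--Schmidt orthogonalisation modulo \<open>U\<close>; the vectors can be used as coordinates which vanish on \<open>U\<close>.
\<close>

lemma orthonormal_chain:
  fixes U W :: "'a::euclidean_space set"
  assumes "subspace U" "subspace W" "U \<subseteq> W"
  shows "\<exists>vs. chain U vs W \<and> distinct vs \<and> pairwise orthogonal (set vs) \<and>
    (\<forall>v\<in>set vs. norm v = 1 \<and> v \<in> W \<and> (\<forall>u\<in>U. orthogonal v u))"
  using assms
proof (induction "dim W - dim U" arbitrary: U rule: less_induct)
  case less
  show ?case
  proof (cases "U = W")
    case True
    then show ?thesis by (intro exI[of _ "[]"]) auto
  next
    case False
    then obtain w where w: "w \<in> W" "w \<notin> U" using less by auto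
    obtain y z where yz: "y \<in> U" "\<And>u. u \<in> U \<Longrightarrow> orthogonal z u" "w = y + z"
      using orthogonal_subspace_decomp_exists[of U w] less.prems(1)
      by (metis span_eq_iff)
    then have "z \<noteq> 0" using w by auto
    define v where "v = z /\<^sub>R norm z"
    have v1: "norm v = 1" using \<open>z \<noteq> 0\<close> by (simp add: v_def)
    have orth: "orthogonal v u" if "u \<in> U" for u
      using yz(2)[OF that] by (simp add: v_def orthogonal_def)
    have "z \<in> W" using yz w less.prems by (metis add_diff_cancel_left' subsetD subspace_diff)
    then have vW: "v \<in> W" using less.prems by (simp add: v_def subspace_scale)
    have vU: "v \<notin> U" using orth[of v] v1 by (auto simp: orthogonal_self)
    let ?U = "span (insert v U)"
    have dim: "dim ?U = dim U + 1" using vU less.prems by (simp add: dim_insert span_eq_iff[THEN iffD2])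
    have sub: "?U \<subseteq> W" using less.prems vW by (intro span_minimal) auto
    then have "dim ?U \<le> dim W" by (rule dim_subset)
    then have "dim W - dim ?U < dim W - dim U" using dim by linarith
    from less.hyps[OF this] sub less.prems obtain vs where vs: "chain ?U vs W" "distinct vs"
      "pairwise orthogonal (set vs)" "\<forall>v\<in>set vs. norm v = 1 \<and> v \<in> W \<and> (\<forall>u\<in>?U. orthogonal v u)"
      by auto
    have in_span: "v \<in> ?U" "U \<subseteq> ?U" by (auto simp: span_base)
    have "v \<notin> set vs" using vs(4) in_span(1) v1 by (metis norm_zero orthogonal_self zero_neq_one)
    moreover have "pairwise orthogonal (insert v (set vs))"
      using vs(3,4) in_span(1) by (auto simp: pairwise_insert orthogonal_commute)
    moreover have "\<forall>x\<in>set (v # vs). norm x = 1 \<and> x \<in> W \<and> (\<forall>u\<in>U. orthogonal x u)"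
      using vs(4) in_span v1 vW orth by auto
    ultimately show ?thesis using vs vU by (intro exI[of _ "v # vs"]) auto
  qed
qed

lemma chain_exists:
  fixes U W :: "'a::euclidean_space set"
  assumes "subspace U" "subspace W" "U \<subseteq> W"
  shows "\<exists>vs. chain U vs W"
  using orthonormal_chain[OF assms] by blast

lemma line_int_same_span:
  assumes U: "subspace U" "v \<notin> U" "w \<notin> U" "span (insert v U) = span (insert w U)"
  shows "\<exists>c<\<infinity>. \<forall>f\<in>borel_measurable borel. invariant U f \<longrightarrow> (\<forall>x. line_int v f x = c * line_int w f x)"
proof -
  have "v \<in> span (insert w U)" using U(4) by (metis insertI1 span_base)
  then obtain a where a: "v - a *\<^sub>R w \<in> U" using U(1) by (auto simp: span_breakdown_eq span_eq_iff[THEN iffD2])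
  have "a \<noteq> 0" using a U(2) by auto
  have "line_int v f x = ennreal (1 / \<bar>a\<bar>) * line_int w f x"
    if [measurable]: "f \<in> borel_measurable borel" and inv: "invariant U f" for f x
  proof -
    have "f (x + t *\<^sub>R v) = f (x + (0 + a * t) *\<^sub>R w)" for t
    proof -
      have "x + t *\<^sub>R v = x + (0 + a * t) *\<^sub>R w + t *\<^sub>R (v - a *\<^sub>R w)" by (simp add: algebra_simps)
      moreover have "t *\<^sub>R (v - a *\<^sub>R w) \<in> U" using a U(1) by (rule subspace_scale[rotated])
      ultimately show ?thesis using inv by (metis invariant_def)
    qed
    then have "line_int v f x = (\<integral>\<^sup>+t. f (x + (0 + a * t) *\<^sub>R w) \<partial>lborel)" by (simp add: line_int_def)
    moreover have "line_int w f x = ennreal \<bar>a\<bar> * (\<integral>\<^sup>+t. f (x + (0 + a * t) *\<^sub>R w) \<partial>lborel)"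
      unfolding line_int_def using \<open>a \<noteq> 0\<close> by (intro nn_integral_real_affine) auto
    moreover have "ennreal (1 / \<bar>a\<bar>) * ennreal \<bar>a\<bar> = 1"
      using \<open>a \<noteq> 0\<close> by (simp flip: ennreal_mult')
    ultimately show ?thesis by (metis mult.assoc mult.left_neutral)
  qed
  then show ?thesis by (intro exI[of _ "ennreal (1 / \<bar>a\<bar>)"]) auto
qed

text \<open>
  Change of variables without determinants, in the style of the Jordan--Hoelder theorem. If the
  two chains begin with the same subspace, the first integrals agree up to a factor. Otherwise both are
  compared with chains that begin with \<open>v, w\<close> and with \<open>w, v\<close> and agree afterwards, for which
  the first two integrations commute.
\<close>

lemma iter_int_change_chain:
  assumes "subspace U" "chain U vs W" "chain U ws W"
  shows "\<exists>c<\<infinity>. \<forall>f\<in>borel_measurable borel. invariant U f \<longrightarrow> (\<forall>x. iter_int vs f x = c * iter_int ws f x)"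
  using assms
proof (induction "length vs" arbitrary: U vs ws rule: less_induct)
  case less
  have len: "length vs = length ws"
    using chain_subspace[OF less.prems(1,2)] chain_subspace[OF less.prems(1,3)] by simp
  show ?case
  proof (cases vs)
    case Nil
    then show ?thesis using len by (intro exI[of _ 1]) auto
  next
    case (Cons v vs')
    then obtain w ws' where ws: "ws = w # ws'" using len by (cases ws) auto
    let ?V = "span (insert v U)" and ?W = "span (insert w U)"
    have v: "v \<notin> U" "chain ?V vs' W" and w: "w \<notin> U" "chain ?W ws' W"
      using less.prems Cons ws by auto
    show ?thesis
    proof (cases "?V = ?W")
      case True
      obtain c where c: "c < \<infinity>" "\<And>f x. f \<in> borel_measurable borel \<Longrightarrow> invariant U f \<Longrightarrow> line_int v f x = c * line_int w f x"
        using line_int_same_span[OF less.prems(1) v(1) w(1) True] by auto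
      obtain d where d: "d < \<infinity>" "\<And>f x. f \<in> borel_measurable borel \<Longrightarrow> invariant ?W f \<Longrightarrow> iter_int vs' f x = d * iter_int ws' f x"
        using less.hyps[of vs' ?W ws'] v w True Cons by auto
      have "iter_int vs f x = c * d * iter_int ws f x" if f: "f \<in> borel_measurable borel" "invariant U f" for f x
      proof -
        have "line_int v f = (\<lambda>x. c * line_int w f x)" using c(2) f by auto
        then have "iter_int vs f x = c * iter_int vs' (line_int w f) x"
          using Cons f by (simp add: iter_int_cmult measurable_line_int)
        also have "iter_int vs' (line_int w f) x = d * iter_int ws' (line_int w f) x"
          using f less.prems(1) by (intro d(2) measurable_line_int invariant_span_insert_line_int) auto
        finally show ?thesis by (simp add: ws mult.assoc)
      qed
      then show ?thesis using c(1) d(1) by (intro exI[of _ "c * d"]) (auto simp: ennreal_mult_less_top)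
    next
      case False
      have vW: "v \<notin> ?W"
      proof
        assume "v \<in> ?W"
        then have "w \<in> ?V" using v(1) in_span_insert[of v w U] less.prems(1) by (metis span_eq_iff)
        then have "?V = ?W" using \<open>v \<in> ?W\<close>
          by (intro equalityI span_minimal) (auto simp: span_base)
        then show False using False by simp
      qed
      have wV: "w \<notin> ?V"
      proof
        assume "w \<in> ?V"
        then have "v \<in> ?W" using w(1) in_span_insert[of w v U] less.prems(1) by (metis span_eq_iff)
        then show False using vW by simp
      qed
      let ?X = "span (insert v (insert w U))"
      have X: "span (insert w ?V) = ?X" "span (insert v ?W) = ?X"
        by (simp_all only: span_insert[of _ "span _"] span_span) (simp_all only: flip: span_insert add: insert_commute)
      have "?V \<subseteq> W" "?W \<subseteq> W" "subspace W"
        using chain_subspace[OF _ v(2)] chain_subspace[OF _ w(2)] by auto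
      then have "?X \<subseteq> W" by (intro span_minimal) (auto dest: subsetD simp: span_base)
      then obtain zs where zs: "chain ?X zs W" using chain_exists[of ?X W] \<open>subspace W\<close> by auto
      obtain c where c: "c < \<infinity>" "\<And>f x. f \<in> borel_measurable borel \<Longrightarrow> invariant ?V f \<Longrightarrow> iter_int vs' f x = c * iter_int (w # zs) f x"
        using less.hyps[of vs' ?V "w # zs"] v wV zs Cons X by auto
      obtain d where d: "d < \<infinity>" "\<And>f x. f \<in> borel_measurable borel \<Longrightarrow> invariant ?W f \<Longrightarrow> iter_int (v # zs) f x = d * iter_int ws' f x"
      proof -
        have "dim (span (insert v ?W)) = dim ?W + 1" using vW
          by (simp only: dim_span[of "insert v _"] dim_insert[of v "span _"] span_span if_False)
        then have "dim ?X = dim ?W + 1" by (simp only: X(2))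
        moreover have "dim W = dim ?X + length zs" "dim W = dim ?W + length ws'"
          using chain_subspace[OF _ zs] chain_subspace[OF _ w(2)] by blast+
        ultimately have "length (v # zs) < length vs" using Cons len ws by simp
        then show ?thesis using less.hyps[of "v # zs" ?W ws'] w vW zs X that by auto
      qed
      have "iter_int vs f x = c * d * iter_int ws f x" if f: "f \<in> borel_measurable borel" "invariant U f" for f x
      proof -
        have "iter_int vs f x = c * iter_int (w # zs) (line_int v f) x"
          using Cons f c(2)[of "line_int v f"] less.prems(1)
          by (auto intro: measurable_line_int invariant_span_insert_line_int)
        also have "\<dots> = c * iter_int (v # zs) (line_int w f) x"
          using line_int_commute[OF f(1)] by simp
        also have "iter_int (v # zs) (line_int w f) x = d * iter_int ws' (line_int w f) x"
          using f less.prems(1) by (intro d(2) measurable_line_int invariant_span_insert_line_int) auto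
        finally show ?thesis by (simp add: ws mult.assoc)
      qed
      then show ?thesis using c(1) d(1) by (intro exI[of _ "c * d"]) (auto simp: ennreal_mult_less_top)
    qed
  qed
qed

lemma iter_int_Holder:
  assumes "f \<in> borel_measurable borel" "g \<in> borel_measurable borel" and t: "0 < t" "t < 1"
  shows "iter_int vs (\<lambda>x. ennreal_powr (f x) (1 - t) * ennreal_powr (g x) t) x
    \<le> ennreal_powr (iter_int vs f x) (1 - t) * ennreal_powr (iter_int vs g x) t"
  using assms(1,2)
proof (induction vs arbitrary: f g)
  case (Cons v vs)
  note [measurable] = Cons.prems
  have "iter_int (v # vs) (\<lambda>x. ennreal_powr (f x) (1 - t) * ennreal_powr (g x) t) x
    \<le> iter_int vs (\<lambda>x. ennreal_powr (line_int v f x) (1 - t) * ennreal_powr (line_int v g x) t) x"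
    unfolding iter_int.simps
  proof (rule iter_int_mono)
    show "line_int v (\<lambda>x. ennreal_powr (f x) (1 - t) * ennreal_powr (g x) t) x
       \<le> ennreal_powr (line_int v f x) (1 - t) * ennreal_powr (line_int v g x) t" for x
      unfolding line_int_def by (intro nn_integral_Holder t) measurable
  qed
  also have "\<dots> \<le> ennreal_powr (iter_int (v # vs) f x) (1 - t) * ennreal_powr (iter_int (v # vs) g x) t"
    unfolding iter_int.simps by (intro Cons.IH measurable_line_int Cons.prems)
  finally show ?case .
qed simp

lemma iter_int_eq_PiM:
  fixes p :: "'c \<Rightarrow> 'a::euclidean_space"
  assumes "distinct bs" "F \<in> borel_measurable borel"
  shows "iter_int (map p bs) F x = (\<integral>\<^sup>+c. F (x + (\<Sum>b\<in>set bs. c b *\<^sub>R p b)) \<partial>(PiM (set bs) (\<lambda>_. lborel)))"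
  using assms
proof (induction bs arbitrary: F)
  case Nil
  then show ?case by (simp add: PiM_empty nn_integral_count_space_finite)
next
  case (Cons b bs)
  note [measurable] = Cons.prems(2)
  interpret product_sigma_finite "\<lambda>_::'c. lborel :: real measure" by standard
  have b: "b \<notin> set bs" using Cons.prems by simp
  have "iter_int (map p (b # bs)) F x = iter_int (map p bs) (line_int (p b) F) x" by simp
  also have "\<dots> = (\<integral>\<^sup>+c. line_int (p b) F (x + (\<Sum>b\<in>set bs. c b *\<^sub>R p b)) \<partial>(PiM (set bs) (\<lambda>_. lborel)))"
    using Cons by (intro Cons.IH) auto
  also have "\<dots> = (\<integral>\<^sup>+c. \<integral>\<^sup>+t. F (x + (\<Sum>b'\<in>set (b # bs). (c(b := t)) b' *\<^sub>R p b')) \<partial>lborel \<partial>(PiM (set bs) (\<lambda>_. lborel)))"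
  proof (intro nn_integral_cong)
    fix c :: "'c \<Rightarrow> real"
    have "(\<Sum>b'\<in>set bs. (c(b := t)) b' *\<^sub>R p b') = (\<Sum>b'\<in>set bs. c b' *\<^sub>R p b')" for t
      using b by (intro sum.cong) auto
    then show "line_int (p b) F (x + (\<Sum>b\<in>set bs. c b *\<^sub>R p b))
        = (\<integral>\<^sup>+t. F (x + (\<Sum>b'\<in>set (b # bs). (c(b := t)) b' *\<^sub>R p b')) \<partial>lborel)"
      using b by (simp add: line_int_def add_ac)
  qed
  also have "\<dots> = (\<integral>\<^sup>+c. F (x + (\<Sum>b'\<in>set (b # bs). c b' *\<^sub>R p b')) \<partial>(PiM (set (b # bs)) (\<lambda>_. lborel)))"
    using b by (subst list.set(2), subst product_nn_integral_insert) (auto simp del: fun_upd_apply)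
  finally show ?case .
qed

section \<open>Finiteness of the Brascamp--Lieb constant\<close>

lemma measurable_prod_powr:
  assumes [measurable]: "\<And>i. i \<in> I \<Longrightarrow> f i \<in> borel_measurable M"
  shows "(\<lambda>x. \<Prod>i\<in>I. ennreal_powr (f i x) (p i)) \<in> borel_measurable M"
  by measurable

context subspace_arrangement
begin

text \<open>
  The inequality for the maps induced on \<open>W / U\<close>, where \<open>vs\<close> and \<open>ws i\<close> are chains from \<open>U\<close> to \<open>W\<close> and from
  \<open>U + K i\<close> to \<open>W + K i\<close>. It is required at every point \<open>x\<close>, that is, on every translate of \<open>W\<close>, so that it
  can be integrated further when two intervals are glued.
\<close>

definition brascamp_lieb_bound ::
  "(nat \<Rightarrow> real) \<Rightarrow> 'a set \<Rightarrow> 'a list \<Rightarrow> (nat \<Rightarrow> 'a list) \<Rightarrow> ennreal \<Rightarrow> bool" where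
  "brascamp_lieb_bound \<tau> U vs ws C \<longleftrightarrow>
     (\<forall>f. (\<forall>i\<in>{1..N}. f i \<in> borel_measurable borel \<and> invariant (join i U) (f i)) \<longrightarrow>
       (\<forall>x. iter_int vs (\<lambda>x. \<Prod>i=1..N. ennreal_powr (f i x) (\<tau> i)) x
          \<le> C * (\<Prod>i=1..N. ennreal_powr (iter_int (ws i) (f i) x) (\<tau> i))))"

definition brascamp_lieb :: "'a set \<Rightarrow> 'a set \<Rightarrow> (nat \<Rightarrow> real) \<Rightarrow> bool" where
  "brascamp_lieb U W \<tau> \<longleftrightarrow> (\<exists>vs ws C. chain U vs W \<and> (\<forall>i. chain (join i U) (ws i) (join i W)) \<and> C < \<infinity> \<and> brascamp_lieb_bound \<tau> U vs ws C)"

lemma brascamp_lieb_boundD: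
  assumes "brascamp_lieb_bound \<tau> U vs ws C" "\<And>i. i \<in> {1..N} \<Longrightarrow> f i \<in> borel_measurable borel"
    "\<And>i. i \<in> {1..N} \<Longrightarrow> invariant (join i U) (f i)"
  shows "iter_int vs (\<lambda>x. \<Prod>i=1..N. ennreal_powr (f i x) (\<tau> i)) x
    \<le> C * (\<Prod>i=1..N. ennreal_powr (iter_int (ws i) (f i) x) (\<tau> i))"
  using assms by (simp add: brascamp_lieb_bound_def)

lemma invariant_prod_powr:
  assumes "\<And>i. i \<in> {1..N} \<Longrightarrow> invariant (join i U) (f i)"
  shows "invariant U (\<lambda>x. \<Prod>i=1..N. ennreal_powr (f i x) (\<tau> i))"
  unfolding invariant_def
proof (intro allI ballI prod.cong refl)
  fix x u i assume "u \<in> U" "i \<in> {1..N}"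
  then have "f i (x + u) = f i x" using assms subset_join[of U i] by (auto simp: invariant_def)
  then show "ennreal_powr (f i (x + u)) (\<tau> i) = ennreal_powr (f i x) (\<tau> i)" by simp
qed

text \<open>
  Finiteness does not depend on the choice of chains, because a change of chain costs only a factor.
  This is needed to compare two inequalities that come with unrelated chains.
\<close>

lemma brascamp_lieb_any_chain:
  assumes BL: "brascamp_lieb U W \<tau>" and U: "subspace U" and adm: "admissible \<tau>"
    and vs: "chain U vs W" and ws: "\<And>i. chain (join i U) (ws i) (join i W)"
  shows "\<exists>C<\<infinity>. brascamp_lieb_bound \<tau> U vs ws C"
proof -
  obtain vs' ws' C where vs': "chain U vs' W" and ws': "\<And>i. chain (join i U) (ws' i) (join i W)"
    and C: "C < \<infinity>" "brascamp_lieb_bound \<tau> U vs' ws' C" using BL by (auto simp: brascamp_lieb_def)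
  obtain c where c: "c < \<infinity>"
    "\<And>f x. f \<in> borel_measurable borel \<Longrightarrow> invariant U f \<Longrightarrow> iter_int vs f x = c * iter_int vs' f x"
    using iter_int_change_chain[OF U vs vs'] by auto
  have "\<exists>d. \<forall>i. d i < \<infinity> \<and> (\<forall>f\<in>borel_measurable borel. invariant (join i U) f \<longrightarrow>
      (\<forall>x. iter_int (ws' i) f x = d i * iter_int (ws i) f x))"
    using iter_int_change_chain[OF subspace_join ws' ws] by (intro choice) auto
  then obtain d where d: "\<And>i. d i < \<infinity>"
    "\<And>i f x. f \<in> borel_measurable borel \<Longrightarrow> invariant (join i U) f \<Longrightarrow> iter_int (ws' i) f x = d i * iter_int (ws i) f x"
    by auto
  define D where "D = (\<Prod>i=1..N. ennreal_powr (d i) (\<tau> i))"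
  have "D < \<infinity>" unfolding D_def using d(1) ennreal_powr_finite
    by (induction N) (auto simp: ennreal_mult_less_top)
  moreover have "brascamp_lieb_bound \<tau> U vs ws (c * C * D)"
    unfolding brascamp_lieb_bound_def
  proof (intro allI impI)
    fix f :: "nat \<Rightarrow> 'a \<Rightarrow> ennreal" and x
    assume "\<forall>i\<in>{1..N}. f i \<in> borel_measurable borel \<and> invariant (join i U) (f i)"
    then have f: "\<And>i. i \<in> {1..N} \<Longrightarrow> f i \<in> borel_measurable borel" "\<And>i. i \<in> {1..N} \<Longrightarrow> invariant (join i U) (f i)"
      by auto
    let ?F = "\<lambda>x. \<Prod>i=1..N. ennreal_powr (f i x) (\<tau> i)"
    have "iter_int vs ?F x = c * iter_int vs' ?F x"
      by (intro c(2) measurable_prod_powr invariant_prod_powr f)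
    also have "\<dots> \<le> c * (C * (\<Prod>i=1..N. ennreal_powr (iter_int (ws' i) (f i) x) (\<tau> i)))"
      by (intro mult_left_mono brascamp_lieb_boundD[OF C(2)] f) auto
    also have "(\<Prod>i=1..N. ennreal_powr (iter_int (ws' i) (f i) x) (\<tau> i))
        = (\<Prod>i=1..N. ennreal_powr (d i) (\<tau> i) * ennreal_powr (iter_int (ws i) (f i) x) (\<tau> i))"
      using adm f by (intro prod.cong refl) (simp add: d(2) ennreal_powr_mult admissible_def)
    finally show "iter_int vs ?F x \<le> c * C * D * (\<Prod>i=1..N. ennreal_powr (iter_int (ws i) (f i) x) (\<tau> i))"
      by (simp add: D_def prod.distrib mult.assoc)
  qed
  ultimately show ?thesis using c(1) C(1) by (intro exI[of _ "c * C * D"]) (auto simp: ennreal_mult_less_top)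
qed

lemma join_chain_exists: "U \<subseteq> W \<Longrightarrow> \<exists>ws. \<forall>i. chain (join i U) (ws i) (join i W)"
  by (intro choice allI chain_exists join_mono subspace_join)

text \<open>
  Functions whose map vanishes on the line \<open>W / U\<close> are constant along it, and the exponents of
  the others add up to \<open>1\<close>: this is Hoelder's inequality with constant \<open>1\<close>.
\<close>

lemma brascamp_lieb_line:
  assumes U: "subspace U" "subspace W" "U \<subset> W" "dim W = dim U + 1"
    and adm: "admissible \<tau>" and feas: "feasible \<tau> U W"
  shows "brascamp_lieb U W \<tau>"
proof -
  obtain w where w: "w \<notin> U" "W = span (insert w U)"
    using dim_step_span_insert[OF U(1,2) _ U(4)] U(3) by auto
  define ws where "ws i = (if w \<in> join i U then [] else [w])" for i
  have "chain U [w] W" using w by simp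
  moreover have "chain (join i U) (ws i) (join i W)" for i
    unfolding w(2) join_insert by (auto simp: ws_def insert_absorb span_eq_iff[THEN iffD2])
  moreover have "brascamp_lieb_bound \<tau> U [w] ws 1"
    unfolding brascamp_lieb_bound_def
  proof (intro allI impI)
    fix f :: "nat \<Rightarrow> 'a \<Rightarrow> ennreal" and x
    assume "\<forall>i\<in>{1..N}. f i \<in> borel_measurable borel \<and> invariant (join i U) (f i)"
    then have f [measurable]: "\<And>i. i \<in> {1..N} \<Longrightarrow> f i \<in> borel_measurable borel"
      and inv: "\<And>i. i \<in> {1..N} \<Longrightarrow> invariant (join i U) (f i)" by auto
    define I where "I = {i\<in>{1..N}. w \<notin> join i U}"
    define I' where "I' = {i\<in>{1..N}. w \<in> join i U}"
    have II: "{1..N} = I \<union> I'" "I \<inter> I' = {}" "finite I" "finite I'" by (auto simp: I_def I'_def)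
    have "(\<Sum>i=1..N. \<tau> i * (real (dim (join i W)) - real (dim (join i U)))) = (\<Sum>i=1..N. if w \<notin> join i U then \<tau> i else 0)"
      unfolding w(2) join_dim_insert by (intro sum.cong) auto
    also have "\<dots> = sum \<tau> I" unfolding I_def by (rule sum.inter_filter[symmetric]) simp
    finally have sumI: "sum \<tau> I = 1"
      using feas excess_diff[of \<tau> W U] U(4) by (simp add: feasible_def)
    have const: "f i (x + t *\<^sub>R w) = f i x" if "i \<in> I'" for i t
      using inv[of i] that subspace_scale[OF subspace_join, of w i U t] by (auto simp: invariant_def I'_def)
    have split: "(\<Prod>i=1..N. h i) = (\<Prod>i\<in>I'. h i) * (\<Prod>i\<in>I. h i)" for h :: "nat \<Rightarrow> ennreal"
      unfolding II(1) by (simp add: prod.union_disjoint II mult.commute)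
    define c where "c = (\<Prod>i\<in>I'. ennreal_powr (f i x) (\<tau> i))"
    have "line_int w (\<lambda>x. \<Prod>i=1..N. ennreal_powr (f i x) (\<tau> i)) x
      = (\<integral>\<^sup>+t. c * (\<Prod>i\<in>I. ennreal_powr (f i (x + t *\<^sub>R w)) (\<tau> i)) \<partial>lborel)"
      unfolding line_int_def II(1) by (simp add: prod.union_disjoint II const c_def mult.commute)
    also have "\<dots> = c * (\<integral>\<^sup>+t. (\<Prod>i\<in>I. ennreal_powr (f i (x + t *\<^sub>R w)) (\<tau> i)) \<partial>lborel)"
      by (intro nn_integral_cmult measurable_prod_powr measurable_compose[OF _ f]) (auto simp: I_def)
    also have "\<dots> \<le> c * (\<Prod>i\<in>I. ennreal_powr (\<integral>\<^sup>+t. f i (x + t *\<^sub>R w) \<partial>lborel) (\<tau> i))"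
    proof (intro mult_left_mono nn_integral_Holder_prod II sumI)
      show "(\<lambda>t. f i (x + t *\<^sub>R w)) \<in> borel_measurable lborel" if "i \<in> I" for i
        using that by (intro measurable_compose[OF _ f]) (auto simp: I_def)
      show "0 \<le> \<tau> i" if "i \<in> I" for i using that adm by (auto simp: I_def admissible_def)
    qed simp
    also have "(\<Prod>i\<in>I. ennreal_powr (\<integral>\<^sup>+t. f i (x + t *\<^sub>R w) \<partial>lborel) (\<tau> i))
        = (\<Prod>i\<in>I. ennreal_powr (iter_int (ws i) (f i) x) (\<tau> i))"
      by (intro prod.cong) (auto simp: I_def ws_def line_int_def)
    also have "c = (\<Prod>i\<in>I'. ennreal_powr (iter_int (ws i) (f i) x) (\<tau> i))"
      unfolding c_def by (intro prod.cong) (auto simp: I'_def ws_def)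
    finally show "iter_int [w] (\<lambda>x. \<Prod>i=1..N. ennreal_powr (f i x) (\<tau> i)) x
      \<le> 1 * (\<Prod>i=1..N. ennreal_powr (iter_int (ws i) (f i) x) (\<tau> i))"
      by (simp only: split[of "\<lambda>i. ennreal_powr (iter_int (ws i) (f i) x) (\<tau> i)"] iter_int.simps mult_1_left)
  qed
  ultimately show ?thesis unfolding brascamp_lieb_def by (intro exI[of _ "[w]"] exI[of _ ws] exI[of _ 1]) auto
qed

text \<open>
  The inequality between \<open>U\<close> and \<open>V\<close> bounds the inner integral by the product of the powers of the partially
  integrated functions. These are invariant under \<open>V + K i\<close>, so the second inequality applies to them.
\<close>

lemma brascamp_lieb_glue:
  assumes UV: "brascamp_lieb U V \<tau>" and VW: "brascamp_lieb V W \<tau>" and U: "subspace U"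
  shows "brascamp_lieb U W \<tau>"
proof -
  obtain vs ws C where vs: "chain U vs V" "\<And>i. chain (join i U) (ws i) (join i V)" "C < \<infinity>" "brascamp_lieb_bound \<tau> U vs ws C"
    using UV by (auto simp: brascamp_lieb_def)
  obtain vs' ws' C' where vs': "chain V vs' W" "\<And>i. chain (join i V) (ws' i) (join i W)" "C' < \<infinity>" "brascamp_lieb_bound \<tau> V vs' ws' C'"
    using VW by (auto simp: brascamp_lieb_def)
  have "brascamp_lieb_bound \<tau> U (vs @ vs') (\<lambda>i. ws i @ ws' i) (C * C')"
    unfolding brascamp_lieb_bound_def
  proof (intro allI impI)
    fix f :: "nat \<Rightarrow> 'a \<Rightarrow> ennreal" and x
    assume "\<forall>i\<in>{1..N}. f i \<in> borel_measurable borel \<and> invariant (join i U) (f i)"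
    then have f: "\<And>i. i \<in> {1..N} \<Longrightarrow> f i \<in> borel_measurable borel" "\<And>i. i \<in> {1..N} \<Longrightarrow> invariant (join i U) (f i)"
      by auto
    define g where "g i = iter_int (ws i) (f i)" for i
    have g: "\<And>i. i \<in> {1..N} \<Longrightarrow> g i \<in> borel_measurable borel" "\<And>i. i \<in> {1..N} \<Longrightarrow> invariant (join i V) (g i)"
      unfolding g_def using f vs(2) by (auto intro!: measurable_iter_int invariant_iter_int[OF _ _ subspace_join vs(2)])
    let ?F = "\<lambda>x. \<Prod>i=1..N. ennreal_powr (f i x) (\<tau> i)"
    let ?G = "\<lambda>x. \<Prod>i=1..N. ennreal_powr (g i x) (\<tau> i)"
    have "iter_int (vs @ vs') ?F x \<le> iter_int vs' (\<lambda>x. C * ?G x) x"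
      unfolding iter_int_append g_def by (intro iter_int_mono brascamp_lieb_boundD[OF vs(4)] f)
    also have "\<dots> = C * iter_int vs' ?G x"
      by (subst iter_int_cmult) (auto intro!: measurable_prod_powr g)
    also have "\<dots> \<le> C * (C' * (\<Prod>i=1..N. ennreal_powr (iter_int (ws' i) (g i) x) (\<tau> i)))"
      by (intro mult_left_mono brascamp_lieb_boundD[OF vs'(4)] g) auto
    finally show "iter_int (vs @ vs') ?F x \<le> C * C' * (\<Prod>i=1..N. ennreal_powr (iter_int (ws i @ ws' i) (f i) x) (\<tau> i))"
      by (simp add: iter_int_append g_def mult.assoc)
  qed
  moreover have "chain U (vs @ vs') W" using vs(1) vs'(1) by (rule chain_append)
  moreover have "chain (join i U) (ws i @ ws' i) (join i W)" for i using vs(2) vs'(2) by (rule chain_append)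
  moreover have "C * C' < \<infinity>" using vs(3) vs'(3) by (simp add: ennreal_mult_less_top)
  ultimately show ?thesis unfolding brascamp_lieb_def
    by (intro exI[of _ "vs @ vs'"] exI[of _ "\<lambda>i. ws i @ ws' i"] exI[of _ "C * C'"]) simp
qed

text \<open>
  Interpolation between exponents is a single use of Hoelder's inequality on the left, while the right-hand
  side is already multiplicative in the exponents.
\<close>

lemma brascamp_lieb_convex:
  assumes UW: "subspace U" "subspace W" "U \<subset> W" and adm: "admissible \<tau>" "admissible \<tau>'"
    and t: "0 < t" "t < 1" and BL: "brascamp_lieb U W \<tau>" "brascamp_lieb U W \<tau>'"
  shows "brascamp_lieb U W (\<lambda>i. (1 - t) * \<tau> i + t * \<tau>' i)"
proof -
  have sub: "U \<subseteq> W" using UW by auto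
  obtain vs where vs: "chain U vs W" using chain_exists[OF UW(1,2) sub] by auto
  obtain ws where ws: "\<And>i. chain (join i U) (ws i) (join i W)" using join_chain_exists[OF sub] by auto
  obtain C where C: "C < \<infinity>" "brascamp_lieb_bound \<tau> U vs ws C" using brascamp_lieb_any_chain[OF BL(1) UW(1) adm(1) vs ws] by auto
  obtain C' where C': "C' < \<infinity>" "brascamp_lieb_bound \<tau>' U vs ws C'" using brascamp_lieb_any_chain[OF BL(2) UW(1) adm(2) vs ws] by auto
  define D where "D = ennreal_powr C (1 - t) * ennreal_powr C' t"
  have interpolate: "(\<Prod>i=1..N. ennreal_powr (h i) ((1 - t) * \<tau> i + t * \<tau>' i))
      = ennreal_powr (\<Prod>i=1..N. ennreal_powr (h i) (\<tau> i)) (1 - t) * ennreal_powr (\<Prod>i=1..N. ennreal_powr (h i) (\<tau>' i)) t"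
    for h :: "nat \<Rightarrow> ennreal"
  proof -
    have "ennreal_powr (h i) ((1 - t) * \<tau> i + t * \<tau>' i)
        = ennreal_powr (ennreal_powr (h i) (\<tau> i)) (1 - t) * ennreal_powr (ennreal_powr (h i) (\<tau>' i)) t"
      if "i \<in> {1..N}" for i
    proof -
      have "0 \<le> \<tau> i" "0 \<le> \<tau>' i" using adm that by (auto simp: admissible_def)
      then show ?thesis using t by (simp add: ennreal_powr_powr ennreal_powr_add mult.commute)
    qed
    then show ?thesis using t by (simp add: ennreal_powr_prod prod.distrib)
  qed
  have "brascamp_lieb_bound (\<lambda>i. (1 - t) * \<tau> i + t * \<tau>' i) U vs ws D"
    unfolding brascamp_lieb_bound_def
  proof (intro allI impI)
    fix f :: "nat \<Rightarrow> 'a \<Rightarrow> ennreal" and x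
    assume "\<forall>i\<in>{1..N}. f i \<in> borel_measurable borel \<and> invariant (join i U) (f i)"
    then have f: "\<And>i. i \<in> {1..N} \<Longrightarrow> f i \<in> borel_measurable borel" "\<And>i. i \<in> {1..N} \<Longrightarrow> invariant (join i U) (f i)"
      by auto
    let ?F = "\<lambda>x. \<Prod>i=1..N. ennreal_powr (f i x) (\<tau> i)" and ?F' = "\<lambda>x. \<Prod>i=1..N. ennreal_powr (f i x) (\<tau>' i)"
    let ?P = "\<Prod>i=1..N. ennreal_powr (iter_int (ws i) (f i) x) (\<tau> i)"
    let ?P' = "\<Prod>i=1..N. ennreal_powr (iter_int (ws i) (f i) x) (\<tau>' i)"
    have "iter_int vs (\<lambda>x. \<Prod>i=1..N. ennreal_powr (f i x) ((1 - t) * \<tau> i + t * \<tau>' i)) x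
        = iter_int vs (\<lambda>x. ennreal_powr (?F x) (1 - t) * ennreal_powr (?F' x) t) x"
      by (simp only: interpolate)
    also have "\<dots> \<le> ennreal_powr (iter_int vs ?F x) (1 - t) * ennreal_powr (iter_int vs ?F' x) t"
      by (intro iter_int_Holder t measurable_prod_powr f)
    also have "\<dots> \<le> ennreal_powr (C * ?P) (1 - t) * ennreal_powr (C' * ?P') t"
      using t by (intro mult_mono ennreal_powr_mono brascamp_lieb_boundD[OF C(2)] brascamp_lieb_boundD[OF C'(2)] f) auto
    also have "\<dots> = D * (ennreal_powr ?P (1 - t) * ennreal_powr ?P' t)"
      using t by (simp add: ennreal_powr_mult D_def mult_ac)
    finally show "iter_int vs (\<lambda>x. \<Prod>i=1..N. ennreal_powr (f i x) ((1 - t) * \<tau> i + t * \<tau>' i)) x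
        \<le> D * (\<Prod>i=1..N. ennreal_powr (iter_int (ws i) (f i) x) ((1 - t) * \<tau> i + t * \<tau>' i))"
      by (simp only: interpolate)
  qed
  moreover have "D < \<infinity>" unfolding D_def using C(1) C'(1) ennreal_powr_finite by (simp add: ennreal_mult_less_top)
  ultimately show ?thesis using vs ws unfolding brascamp_lieb_def by blast
qed

theorem feasible_imp_brascamp_lieb:
  assumes "subspace U" "subspace W" "U \<subset> W" "admissible \<tau>" "feasible \<tau> U W"
  shows "brascamp_lieb U W \<tau>"
  using assms
proof (induction rule: feasible_induct)
  case line then show ?case by (rule brascamp_lieb_line)
next
  case (glue U V W \<tau>) then show ?case using brascamp_lieb_glue[of U V \<tau> W] by blast
next
  case (convex U W \<tau> \<tau>' t) then show ?case by (intro brascamp_lieb_convex)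
qed

end

lemma iter_int_box:
  assumes bs: "distinct bs" "pairwise orthogonal (set bs)" "\<And>b. b \<in> set bs \<Longrightarrow> norm b = 1"
    and r: "\<And>b. b \<in> set bs \<Longrightarrow> 0 \<le> r b"
  shows "iter_int bs (indicator {x. \<forall>b\<in>set bs. \<bar>x \<bullet> b\<bar> \<le> r b}) 0 = ennreal (\<Prod>b\<in>set bs. 2 * r b)"
proof -
  interpret product_sigma_finite "\<lambda>_::'a. lborel :: real measure" by standard
  let ?S = "{x. \<forall>b\<in>set bs. \<bar>x \<bullet> b\<bar> \<le> r b}"
  have "?S = (\<Inter>b\<in>set bs. {x. \<bar>x \<bullet> b\<bar> \<le> r b})" by auto
  moreover have "closed \<dots>" by (intro closed_INT ballI closed_Collect_le continuous_intros)
  ultimately have S: "indicator ?S \<in> borel_measurable borel" by simp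
  have "iter_int bs (indicator ?S) 0 = iter_int (map (\<lambda>b. b) bs) (indicator ?S) 0" by simp
  also have "\<dots> = (\<integral>\<^sup>+c. indicator ?S (0 + (\<Sum>b\<in>set bs. c b *\<^sub>R b)) \<partial>(PiM (set bs) (\<lambda>_. lborel)))"
    by (rule iter_int_eq_PiM[OF bs(1) S])
  also have "\<dots> = (\<integral>\<^sup>+c. (\<Prod>b\<in>set bs. indicator {- r b..r b} (c b)) \<partial>(PiM (set bs) (\<lambda>_. lborel)))"
  proof (intro nn_integral_cong)
    fix c :: "'a \<Rightarrow> real"
    have coord: "(\<Sum>b\<in>set bs. c b *\<^sub>R b) \<bullet> b' = c b'" if "b' \<in> set bs" for b'
    proof -
      have "(\<Sum>b\<in>set bs. c b *\<^sub>R b) \<bullet> b' = (\<Sum>b\<in>set bs. if b = b' then c b' else 0)"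
        unfolding inner_sum_left
      proof (intro sum.cong refl)
        fix b assume "b \<in> set bs"
        then show "c b *\<^sub>R b \<bullet> b' = (if b = b' then c b' else 0)"
          using bs(2,3) that by (auto simp: pairwise_def orthogonal_def dot_square_norm)
      qed
      then show ?thesis using that by simp
    qed
    show "indicator ?S (0 + (\<Sum>b\<in>set bs. c b *\<^sub>R b)) = (\<Prod>b\<in>set bs. indicator {- r b..r b} (c b) :: ennreal)"
    proof (cases "\<forall>b\<in>set bs. \<bar>c b\<bar> \<le> r b")
      case True
      then have "(\<Prod>b\<in>set bs. indicator {- r b..r b} (c b) :: ennreal) = 1" by (intro prod.neutral) (auto simp: abs_le_iff)
      then show ?thesis using True coord by simp
    next
      case False
      then obtain b where b: "b \<in> set bs" "\<not> \<bar>c b\<bar> \<le> r b" by auto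
      then have "(\<Prod>b\<in>set bs. indicator {- r b..r b} (c b) :: ennreal) = 0"
        by (intro prod_zero) (auto intro!: bexI[of _ b] simp: indicator_def abs_le_iff)
      moreover have "(\<Sum>b\<in>set bs. c b *\<^sub>R b) \<notin> ?S" using coord b by auto
      ultimately show ?thesis by simp
    qed
  qed
  also have "\<dots> = (\<Prod>b\<in>set bs. \<integral>\<^sup>+y. indicator {- r b..r b} y \<partial>lborel)"
    by (rule product_nn_integral_prod) auto
  also have "\<dots> = (\<Prod>b\<in>set bs. ennreal (2 * r b))"
    using r by (intro prod.cong refl) (simp add: nn_integral_indicator emeasure_lborel_Icc)
  also have "\<dots> = ennreal (\<Prod>b\<in>set bs. 2 * r b)" using r by (intro prod_ennreal) auto
  finally show ?thesis .
qed

text \<open>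
  Test with the \<open>R\<close> for which \<open>R\<close> to the power \<open>k - s\<close> is \<open>\<bar>c\<bar> + 1\<close>.
\<close>

lemma powr_bounded_imp_le:
  fixes k s c :: real
  assumes "\<And>R. 1 \<le> R \<Longrightarrow> R powr k \<le> c * R powr s"
  shows "k \<le> s"
proof (rule ccontr)
  assume "\<not> k \<le> s"
  then have d: "k - s > 0" by simp
  define R where "R = (\<bar>c\<bar> + 1) powr (1 / (k - s))"
  have R: "1 \<le> R" unfolding R_def using d by (intro ge_one_powr_ge_zero) auto
  have "R powr (k - s) = \<bar>c\<bar> + 1" unfolding R_def using d by (simp add: powr_powr)
  moreover have "R powr (k - s) \<le> c" using assms[OF R] R by (simp add: powr_diff divide_le_eq)
  ultimately show False by linarith
qed

context subspace_arrangement
begin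

text \<open>
  The test functions are indicators of boxes in orthonormal coordinates: a box in \<open>H\<close> with sides of length
  proportional to \<open>R\<close> along \<open>V\<close> and to \<open>1\<close> across, and for each \<open>i\<close> a box in \<open>\<pi>\<^sub>i(H)\<close> that contains its
  image and has sides proportional to \<open>R\<close> only along \<open>\<pi>\<^sub>i(V)\<close>. The latter is possible for \<open>R \<ge> 1\<close>, since
  the directions across \<open>V\<close> contribute a bounded amount. If \<open>V\<close> is the whole space there are no directions
  across, and every positive \<open>R\<close> is allowed.
\<close>

lemma brascamp_lieb_imp_scaling:
  assumes BL: "brascamp_lieb {0} UNIV \<tau>" and adm: "admissible \<tau>" and V: "subspace V"
  shows "\<exists>c. \<forall>R. 1 \<le> R \<or> (V = UNIV \<and> 0 < R) \<longrightarrow>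
    R powr real (dim V) \<le> c * R powr (\<Sum>i=1..N. \<tau> i * (real (dim (join i V)) - real (dim (join i {0}))))"
proof -
  \<comment> \<open>a vector is a sum of \<open>n\<close> components along an orthonormal basis, so \<open>n\<close> bounds the spread of a box\<close>
  define n where "n = real (DIM('a))"
  have n: "n \<ge> 1" by (simp add: n_def Suc_leI DIM_positive)
  have sub0: "{0} \<subseteq> V" using subspace_0[OF V] by simp
  obtain as where as: "chain {0} as V" "distinct as" "pairwise orthogonal (set as)"
    "\<And>v. v \<in> set as \<Longrightarrow> norm v = 1 \<and> v \<in> V"
    using orthonormal_chain[OF subspace_single_0 V sub0] by auto
  obtain bs where bs: "chain V bs UNIV" "distinct bs" "pairwise orthogonal (set bs)"
    "\<And>v. v \<in> set bs \<Longrightarrow> norm v = 1 \<and> (\<forall>u\<in>V. orthogonal v u)"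
    using orthonormal_chain[OF V subspace_UNIV] by auto
  have "\<exists>ps. \<forall>i. chain (join i {0}) (ps i) (join i V) \<and> distinct (ps i) \<and> pairwise orthogonal (set (ps i)) \<and>
    (\<forall>v\<in>set (ps i). norm v = 1 \<and> v \<in> join i V \<and> (\<forall>u\<in>join i {0}. orthogonal v u))"
    by (intro choice allI orthonormal_chain subspace_join join_mono sub0)
  then obtain ps where ps: "\<And>i. chain (join i {0}) (ps i) (join i V)" "\<And>i. distinct (ps i)"
    "\<And>i. pairwise orthogonal (set (ps i))"
    "\<And>i v. v \<in> set (ps i) \<Longrightarrow> norm v = 1 \<and> v \<in> join i V \<and> (\<forall>u\<in>join i {0}. orthogonal v u)" by metis
  have "\<exists>qs. \<forall>i. chain (join i V) (qs i) (join i UNIV) \<and> distinct (qs i) \<and> pairwise orthogonal (set (qs i)) \<and>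
    (\<forall>v\<in>set (qs i). norm v = 1 \<and> v \<in> join i UNIV \<and> (\<forall>u\<in>join i V. orthogonal v u))"
    by (intro choice allI orthonormal_chain subspace_join join_mono) simp
  then obtain qs where qs: "\<And>i. chain (join i V) (qs i) (join i UNIV)" "\<And>i. distinct (qs i)"
    "\<And>i. pairwise orthogonal (set (qs i))"
    "\<And>i v. v \<in> set (qs i) \<Longrightarrow> norm v = 1 \<and> (\<forall>u\<in>join i V. orthogonal v u)" by metis
  have join: "distinct (xs @ ys) \<and> pairwise orthogonal (set (xs @ ys))"
    if xs: "distinct xs" "pairwise orthogonal (set xs)" "\<And>v. v \<in> set xs \<Longrightarrow> norm v = 1 \<and> v \<in> X"
      and ys: "distinct ys" "pairwise orthogonal (set ys)" "\<And>v. v \<in> set ys \<Longrightarrow> norm v = 1 \<and> (\<forall>u\<in>X. orthogonal v u)"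
    for xs ys :: "'a list" and X
  proof -
    have orth: "orthogonal y x \<and> orthogonal x y" if "x \<in> set xs" "y \<in> set ys" for x y
      using xs(3)[OF that(1)] ys(3)[OF that(2)] by (auto simp: orthogonal_commute)
    have "False" if "x \<in> set xs" "x \<in> set ys" for x
      using orth[OF that] xs(3)[OF that(1)] by (auto simp: orthogonal_self)
    then show ?thesis using xs(1,2) ys(1,2) orth by (auto simp: pairwise_def)
  qed
  have ab: "distinct (as @ bs)" "pairwise orthogonal (set (as @ bs))"
    using join[OF as(2-4) bs(2-4)] by auto
  have pq: "distinct (ps i @ qs i)" "pairwise orthogonal (set (ps i @ qs i))" for i
    using join[OF ps(2,3) _ qs(2-4), of i] ps(4) by auto
  have norm_ab: "norm v = 1" if "v \<in> set (as @ bs)" for v using as(4) bs(4) that by auto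
  have norm_pq: "norm v = 1" if "v \<in> set (ps i @ qs i)" for v i using ps(4) qs(4) that by auto
  have ch: "chain {0} (as @ bs) UNIV" "\<And>i. chain (join i {0}) (ps i @ qs i) (join i UNIV)"
    using chain_append as(1) bs(1) ps(1) qs(1) by blast+
  obtain C where C: "C < \<infinity>" "brascamp_lieb_bound \<tau> {0} (as @ bs) (\<lambda>i. ps i @ qs i) C"
    using brascamp_lieb_any_chain[OF BL subspace_single_0 adm ch] by auto
  have len: "length as = dim V" "\<And>i. real (length (ps i)) = real (dim (join i V)) - real (dim (join i {0}))"
    using chain_subspace[OF subspace_single_0 as(1)] chain_subspace[OF subspace_join ps(1)] by auto
  have card_ab: "card (set as) + card (set bs) = DIM('a)"
    using chain_subspace[OF subspace_single_0 ch(1)] as(2) bs(2) by (simp add: distinct_card)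
  have span_ab: "span (set (as @ bs)) = UNIV"
  proof -
    have "0 \<notin> set (as @ bs)" using norm_ab by force
    then have "independent (set (as @ bs))" using ab(2) pairwise_orthogonal_independent by blast
    then have "dim (set (as @ bs)) = DIM('a)"
      using card_ab ab(1) as(2) bs(2) dim_eq_card_independent distinct_card
      by (metis length_append)
    then show ?thesis using dim_eq_full by blast
  qed
  define m where "m i = length (ps i)" for i
  define q where "q i = length (qs i)" for i
  have key: "ennreal ((2 * R) ^ dim V * 2 ^ card (set bs))
      \<le> C * (\<Prod>i=1..N. ennreal_powr (ennreal ((2 * (n * R)) ^ m i * (2 * n) ^ q i)) (\<tau> i))"
    if R: "1 \<le> R \<or> V = UNIV \<and> 0 < R" for R :: real
  proof -
    have R0: "R > 0" using R by auto
    define r where "r v = (if v \<in> set as then R else 1)" for v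
    define s where "s i v = (if v \<in> set (ps i) then n * R else n)" for i v
    define f where "f i = (indicator {x. \<forall>b\<in>set (ps i @ qs i). \<bar>x \<bullet> b\<bar> \<le> s i b} :: 'a \<Rightarrow> ennreal)" for i
    define F where "F = (indicator {x. \<forall>b\<in>set (as @ bs). \<bar>x \<bullet> b\<bar> \<le> r b} :: 'a \<Rightarrow> ennreal)"
    have fm: "f i \<in> borel_measurable borel" for i
    proof -
      have "{x::'a. \<forall>b\<in>set (ps i @ qs i). \<bar>x \<bullet> b\<bar> \<le> s i b} = (\<Inter>b\<in>set (ps i @ qs i). {x. \<bar>x \<bullet> b\<bar> \<le> s i b})" by auto
      moreover have "closed \<dots>" by (intro closed_INT ballI closed_Collect_le continuous_intros)
      ultimately show ?thesis unfolding f_def by simp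
    qed
    have finv: "invariant (join i {0}) (f i)" for i
      unfolding invariant_def
    proof (intro allI ballI)
      fix x u assume u: "u \<in> join i {0}"
      have "u \<bullet> b = 0" if "b \<in> set (ps i @ qs i)" for b
      proof -
        have "u \<in> join i V" using u join_mono[OF sub0] by auto
        then have "orthogonal b u" using that u ps(4) qs(4) by auto
        then show ?thesis by (simp add: orthogonal_def inner_commute)
      qed
      then show "f i (x + u) = f i x" unfolding f_def by (simp add: indicator_def inner_add_left)
    qed
    have F_le: "F x \<le> (\<Prod>i=1..N. ennreal_powr (f i x) (\<tau> i))" for x
    proof (cases "\<forall>b\<in>set (as @ bs). \<bar>x \<bullet> b\<bar> \<le> r b")
      case False
      then show ?thesis by (simp add: F_def)
    next
      case True
      have expand: "x \<bullet> v = (\<Sum>e\<in>set (as @ bs). (x \<bullet> e) * (e \<bullet> v))" for v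
      proof -
        have "(\<Sum>e\<in>set (as @ bs). (x \<bullet> e) *\<^sub>R e) = x"
          using ab norm_ab span_ab by (intro orthonormal_basis_expand) auto
        then have "x \<bullet> v = (\<Sum>e\<in>set (as @ bs). (x \<bullet> e) *\<^sub>R e) \<bullet> v" by simp
        then show ?thesis by (simp only: inner_sum_left inner_scaleR_left)
      qed
      have unit: "\<bar>e \<bullet> v\<bar> \<le> 1" if "norm e = 1" "norm v = 1" for e v :: 'a
        using Cauchy_Schwarz_ineq2[of e v] that by simp
      have card_n: "real (card (set (as @ bs))) = n"
        using card_ab distinct_card[OF ab(1)] distinct_card[OF as(2)] distinct_card[OF bs(2)]
        by (simp add: n_def del: set_append)
      have "\<bar>x \<bullet> v\<bar> \<le> s i v" if v: "v \<in> set (ps i @ qs i)" for i v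
      proof -
        have "\<bar>(x \<bullet> e) * (e \<bullet> v)\<bar> \<le> s i v / n" if e: "e \<in> set (as @ bs)" for e
        proof -
          have 1: "\<bar>(x \<bullet> e) * (e \<bullet> v)\<bar> \<le> r e * 1"
            unfolding abs_mult using True e unit[OF norm_ab[OF e] norm_pq[OF v]] R0 by (intro mult_mono) (auto simp: r_def)
          show ?thesis
          proof (cases "v \<in> set (ps i)")
            case vp: True
            have "r e \<le> R"
            proof (cases "V = UNIV")
              case True
              then have "bs = []" using bs(1) chain_subspace[OF V bs(1)] by simp
              then show ?thesis using e by (simp add: r_def)
            next
              case False
              then show ?thesis using R by (simp add: r_def)
            qed
            then show ?thesis using 1 vp n by (simp add: s_def)
          next
            case vq: False
            then have vq': "v \<in> set (qs i)" using v by auto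
            show ?thesis
            proof (cases "e \<in> set as")
              case True
              then have "e \<in> join i V" using as(4) subset_join by blast
              then have "e \<bullet> v = 0" using qs(4)[OF vq'] by (auto simp: orthogonal_def inner_commute)
              then show ?thesis using n vq by (simp add: s_def)
            next
              case False
              then show ?thesis using 1 vq n by (simp add: s_def r_def)
            qed
          qed
        qed
        then have "(\<Sum>e\<in>set (as @ bs). \<bar>(x \<bullet> e) * (e \<bullet> v)\<bar>) \<le> real (card (set (as @ bs))) * (s i v / n)"
          by (intro sum_bounded_above)
        then have "(\<Sum>e\<in>set (as @ bs). \<bar>(x \<bullet> e) * (e \<bullet> v)\<bar>) \<le> s i v" using card_n n by simp
        then show ?thesis unfolding expand[of v] by (rule order_trans[OF sum_abs])
      qed
      then have "f i x = 1" for i by (simp add: f_def)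
      then show ?thesis by (simp add: F_def indicator_def)
    qed
    have box_i: "iter_int (ps i @ qs i) (f i) 0 = ennreal ((2 * (n * R)) ^ m i * (2 * n) ^ q i)" for i
    proof -
      have "iter_int (ps i @ qs i) (f i) 0 = ennreal (\<Prod>v\<in>set (ps i @ qs i). 2 * s i v)"
        unfolding f_def using pq norm_pq R0 n by (intro iter_int_box) (auto simp: s_def)
      also have "(\<Prod>v\<in>set (ps i @ qs i). 2 * s i v) = (\<Prod>v\<in>set (ps i). 2 * s i v) * (\<Prod>v\<in>set (qs i). 2 * s i v)"
        using pq(1)[of i] by (simp add: prod.union_disjoint)
      also have "(\<Prod>v\<in>set (qs i). 2 * s i v) = (\<Prod>v\<in>set (qs i). 2 * n)"
        using pq(1)[of i] by (intro prod.cong) (auto simp: s_def)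
      also have "(\<Prod>v\<in>set (ps i). 2 * s i v) = (\<Prod>v\<in>set (ps i). 2 * (n * R))" by (intro prod.cong) (auto simp: s_def)
      finally show ?thesis using ps(2) qs(2) by (simp add: m_def q_def distinct_card)
    qed
    have "iter_int (as @ bs) F 0 \<le> iter_int (as @ bs) (\<lambda>x. \<Prod>i=1..N. ennreal_powr (f i x) (\<tau> i)) 0"
      using F_le by (rule iter_int_mono)
    also have "\<dots> \<le> C * (\<Prod>i=1..N. ennreal_powr (iter_int (ps i @ qs i) (f i) 0) (\<tau> i))"
      using brascamp_lieb_boundD[OF C(2), of f 0] fm finv by auto
    also have "iter_int (as @ bs) F 0 = ennreal ((2 * R) ^ dim V * 2 ^ card (set bs))"
    proof -
      have "iter_int (as @ bs) F 0 = ennreal (\<Prod>v\<in>set (as @ bs). 2 * r v)"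
        unfolding F_def using ab norm_ab R0 by (intro iter_int_box) (auto simp: r_def)
      also have "(\<Prod>v\<in>set (as @ bs). 2 * r v) = (\<Prod>v\<in>set as. 2 * r v) * (\<Prod>v\<in>set bs. 2 * r v)"
        using ab(1) by (simp add: prod.union_disjoint)
      also have "(\<Prod>v\<in>set bs. 2 * r v) = (\<Prod>v\<in>set bs. 2)"
        using ab(1) by (intro prod.cong) (auto simp: r_def)
      also have "(\<Prod>v\<in>set as. 2 * r v) = (\<Prod>v\<in>set as. 2 * R)" by (intro prod.cong) (auto simp: r_def)
      finally show ?thesis using len(1) as(2) by (simp add: distinct_card)
    qed
    finally show ?thesis unfolding box_i .
  qed
  define A where "A = (\<Prod>i=1..N. ((2 * n) ^ (m i + q i)) powr \<tau> i)"
  define e where "e = (\<Sum>i=1..N. \<tau> i * (real (dim (join i V)) - real (dim (join i {0}))))"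
  have "R powr real (dim V) \<le> enn2real C * A * R powr e" if R: "1 \<le> R \<or> V = UNIV \<and> 0 < R" for R
  proof -
    have R0: "R > 0" using R by auto
    have "ennreal_powr (ennreal ((2 * (n * R)) ^ m i * (2 * n) ^ q i)) (\<tau> i)
        = ennreal (((2 * n) ^ (m i + q i)) powr \<tau> i * R powr (\<tau> i * (real (dim (join i V)) - real (dim (join i {0})))))" for i
    proof (cases "\<tau> i = 0")
      case False
      have "(2 * (n * R)) ^ m i * (2 * n) ^ q i = (2 * n) ^ (m i + q i) * R powr m i"
        using R0 n by (simp add: power_mult_distrib power_add powr_realpow)
      then have "((2 * (n * R)) ^ m i * (2 * n) ^ q i) powr \<tau> i
          = ((2 * n) ^ (m i + q i)) powr \<tau> i * R powr (\<tau> i * real (m i))"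
        using R0 n by (simp add: powr_mult powr_powr mult.commute)
      then show ?thesis using False R0 n len(2)[of i] by (simp add: ennreal_powr_ennreal m_def)
    qed (use R0 n in simp)
    then have "(\<Prod>i=1..N. ennreal_powr (ennreal ((2 * (n * R)) ^ m i * (2 * n) ^ q i)) (\<tau> i))
        = ennreal (\<Prod>i=1..N. ((2 * n) ^ (m i + q i)) powr \<tau> i * R powr (\<tau> i * (real (dim (join i V)) - real (dim (join i {0})))))"
      by (simp add: prod_ennreal)
    also have "\<dots> = ennreal (A * R powr e)"
      using R0 by (simp add: prod.distrib A_def e_def powr_sum)
    finally have "ennreal ((2 * R) ^ dim V * 2 ^ card (set bs)) \<le> C * ennreal (A * R powr e)"
      using key[OF R] by simp
    also have "C * ennreal (A * R powr e) = ennreal (enn2real C * (A * R powr e))"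
      using C(1) by (simp add: ennreal_mult' ennreal_enn2real)
    finally have upper: "(2 * R) ^ dim V * 2 ^ card (set bs) \<le> enn2real C * (A * R powr e)"
      by (subst (asm) ennreal_le_iff) (auto simp: A_def intro!: mult_nonneg_nonneg prod_nonneg)
    have "R ^ dim V * 1 \<le> (2 * R) ^ dim V * 2 ^ card (set bs)"
      using R0 by (intro mult_mono power_mono) auto
    from order_trans[OF this upper] show ?thesis using R0 by (simp add: powr_realpow mult.assoc)
  qed
  then show ?thesis unfolding e_def by blast
qed

theorem brascamp_lieb_imp_feasible:
  assumes BL: "brascamp_lieb {0} UNIV \<tau>" and adm: "admissible \<tau>"
  shows "feasible \<tau> {0} UNIV"
proof -
  define e where "e V = (\<Sum>i=1..N. \<tau> i * (real (dim (join i V)) - real (dim (join i {0}))))" for V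
  have le: "real (dim V) \<le> e V" if V: "subspace V" for V
  proof -
    obtain c where "\<And>R. 1 \<le> R \<Longrightarrow> R powr real (dim V) \<le> c * R powr e V"
      using brascamp_lieb_imp_scaling[OF BL adm V] unfolding e_def by blast
    then show ?thesis by (rule powr_bounded_imp_le)
  qed
  have ge: "e UNIV \<le> real (dim (UNIV :: 'a set))"
  proof -
    obtain c where c: "\<And>R. 0 < R \<Longrightarrow> R powr real (dim (UNIV :: 'a set)) \<le> c * R powr e UNIV"
      using brascamp_lieb_imp_scaling[OF BL adm subspace_UNIV] unfolding e_def by blast
    \<comment> \<open>for the whole space the boxes may also shrink, which reverses the comparison of exponents\<close>
    have "R powr - real (dim (UNIV :: 'a set)) \<le> c * R powr - e UNIV" if "1 \<le> R" for R
      using c[of "1 / R"] that by (simp add: powr_minus inverse_powr divide_inverse)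
    then have "- real (dim (UNIV :: 'a set)) \<le> - e UNIV" by (rule powr_bounded_imp_le)
    then show ?thesis by simp
  qed
  have "excess \<tau> {0} \<le> excess \<tau> V" if "subspace V" for V
    using le[OF that] excess_diff[of \<tau> V "{0}"] by (simp add: e_def)
  moreover have "excess \<tau> UNIV = excess \<tau> {0}"
    using le[OF subspace_UNIV] ge excess_diff[of \<tau> UNIV "{0}"] by (simp add: e_def)
  ultimately show ?thesis by (simp add: feasible_def)
qed

end

section \<open>Lebesgue measure on subspaces and the equivalence\<close>

lemma orthonormal_basis_exists:
  fixes f :: "'a::euclidean_space \<Rightarrow> 'b::real_inner"
  assumes f: "linear f"
  shows "\<exists>B. orthonormal_basis_of (range f) B"
proof -
  obtain C where C: "finite C" "span C = span (f ` Basis)" "pairwise orthogonal C"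
    using basis_orthogonal[of "f ` Basis"] by auto
  have range: "span C = range f"
    using linear_span_image[OF f, of Basis] C(2) by simp
  define B where "B = (\<lambda>x. x /\<^sub>R norm x) ` (C - {0})"
  have "span B = span C"
  proof (intro equalityI span_minimal subspace_span subsetI)
    fix b assume "b \<in> B"
    then show "b \<in> span C" by (auto simp: B_def span_base span_scale)
  next
    fix x assume x: "x \<in> C"
    show "x \<in> span B"
    proof (cases "x = 0")
      case False
      then have "x /\<^sub>R norm x \<in> span B" using x by (intro span_base) (auto simp: B_def)
      then have "norm x *\<^sub>R (x /\<^sub>R norm x) \<in> span B" by (rule span_scale)
      then show ?thesis using False by simp
    qed (simp add: span_zero)
  qed
  moreover have "pairwise orthogonal B"
    using C(3) by (auto simp: B_def pairwise_def orthogonal_def)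
  moreover have "finite B" "\<forall>b\<in>B. norm b = 1" using C(1) by (auto simp: B_def)
  ultimately have "orthonormal_basis_of (range f) B" by (simp add: orthonormal_basis_of_def range)
  then show ?thesis by blast
qed

lemma borel_measurable_linear:
  fixes f :: "'a::euclidean_space \<Rightarrow> 'b::real_normed_vector"
  shows "linear f \<Longrightarrow> f \<in> borel_measurable borel"
  by (intro borel_measurable_continuous_onI linear_continuous_on) (simp add: linear_conv_bounded_linear)

text \<open>
  Preimages under \<open>f\<close> of a basis of its range form a basis of the space modulo the kernel of \<open>f\<close>.
\<close>

lemma chain_preimage:
  fixes f :: "'a::euclidean_space \<Rightarrow> 'b::real_vector"
  assumes f: "linear f" and "distinct bs" "independent (set bs)" "\<And>b. b \<in> set bs \<Longrightarrow> f (p b) = b"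
  shows "chain {x. f x = 0} (map p bs) {x. f x \<in> span (set bs)}"
  using assms(2-4)
proof (induction bs rule: rev_induct)
  case (snoc b bs)
  let ?W = "{x. f x \<in> span (set bs)}"
  have ind: "independent (insert b (set bs))" "b \<notin> set bs" using snoc.prems by auto
  have ch: "chain {x. f x = 0} (map p bs) ?W"
  proof (rule snoc.IH)
    show "independent (set bs)" using ind(1) by (rule independent_mono) auto
  qed (use snoc.prems in simp_all)
  have W: "span ?W = ?W"
    using conjunct1[OF chain_subspace[OF linear_subspace_kernel[OF f] ch]] by (simp only: span_eq_iff)
  have "b \<notin> span (set bs)" using ind by (simp add: independent_insert)
  then have "p b \<notin> ?W" using snoc.prems(3) by simp
  moreover have "span (insert (p b) ?W) = {x. f x \<in> span (set (bs @ [b]))}"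
  proof -
    have "x \<in> span (insert (p b) ?W) \<longleftrightarrow> (\<exists>k. f x - k *\<^sub>R b \<in> span (set bs))" for x
      unfolding span_breakdown_eq W using snoc.prems(3)[of b] by (simp add: linear_diff[OF f] linear_scale[OF f])
    moreover have "f x \<in> span (set (bs @ [b])) \<longleftrightarrow> (\<exists>k. f x - k *\<^sub>R b \<in> span (set bs))" for x
      using span_breakdown_eq[of "f x" b "set bs"] by simp
    ultimately show ?thesis by blast
  qed
  ultimately have "chain ?W [p b] {x. f x \<in> span (set (bs @ [b]))}" by simp
  then show ?case using chain_append[OF ch] by simp
qed simp

lemma orthonormal_basis_independent:
  "orthonormal_basis_of V B \<Longrightarrow> independent B"
  unfolding orthonormal_basis_of_def by (metis norm_zero pairwise_orthogonal_independent zero_neq_one)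

text \<open>
  The measure on \<open>f(H)\<close> is built from coordinates; lifting the basis to \<open>H\<close> turns its integral into
  iterated line integrals of the pulled back function. The lift also shows that the coordinate map is
  Borel measurable: it factors through \<open>H\<close>, whereas sums in the codomain need not be measurable
  when that space is not separable.
\<close>

lemma nn_integral_subspace_lborel:
  fixes f :: "'a::euclidean_space \<Rightarrow> 'b::real_inner"
  assumes f: "linear f"
  shows "\<exists>bs p. distinct bs \<and> orthonormal_basis_of (range f) (set bs) \<and> (\<forall>b\<in>set bs. f (p b) = b) \<and>
    chain {x. f x = 0} (map p bs) UNIV \<and>
    (\<forall>g\<in>borel_measurable (restrict_space borel (range f)).
       (\<integral>\<^sup>+y. g y \<partial>subspace_lborel (range f)) = iter_int (map p bs) (\<lambda>x. g (f x)) 0)"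
proof -
  define B where "B = (SOME B. orthonormal_basis_of (range f) B)"
  have B: "orthonormal_basis_of (range f) B"
    unfolding B_def using orthonormal_basis_exists[OF f] by (rule someI_ex)
  obtain bs where bs: "distinct bs" "set bs = B"
    using finite_distinct_list[of B] B by (auto simp: orthonormal_basis_of_def)
  have "B \<subseteq> range f" using B span_superset[of B] by (simp add: orthonormal_basis_of_def)
  then have "\<forall>b\<in>B. \<exists>a. f a = b" by auto
  then obtain p where p: "\<And>b. b \<in> B \<Longrightarrow> f (p b) = b" by metis
  have "span B = range f" using B by (simp add: orthonormal_basis_of_def)
  then have ch: "chain {x. f x = 0} (map p bs) UNIV"
    using chain_preimage[OF f bs(1), of p] orthonormal_basis_independent[OF B] p bs(2) by simp
  have fm: "f \<in> borel \<rightarrow>\<^sub>M restrict_space borel (range f)"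
    using borel_measurable_linear[OF f] by (intro measurable_restrict_space2) auto
  define T where "T c = (\<Sum>b\<in>B. c b *\<^sub>R b)" for c
  have T: "T c = f (\<Sum>b\<in>B. c b *\<^sub>R p b)" for c
    unfolding T_def using p by (simp add: linear_sum[OF f] linear_scale[OF f])
  have "(\<lambda>c. \<Sum>b\<in>B. c b *\<^sub>R p b) \<in> borel_measurable (PiM B (\<lambda>_. lborel))"
    by measurable
  then have Tm: "T \<in> PiM B (\<lambda>_. lborel) \<rightarrow>\<^sub>M restrict_space borel (range f)"
    unfolding T[abs_def] using measurable_compose fm by blast
  have sl: "subspace_lborel (range f) = distr (PiM B (\<lambda>_. lborel)) (restrict_space borel (range f)) T"
    unfolding subspace_lborel_def B_def[symmetric] T_def Let_def ..
  have "(\<integral>\<^sup>+y. g y \<partial>subspace_lborel (range f)) = iter_int (map p bs) (\<lambda>x. g (f x)) 0"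
    if g: "g \<in> borel_measurable (restrict_space borel (range f))" for g
  proof -
    have "(\<integral>\<^sup>+y. g y \<partial>subspace_lborel (range f)) = (\<integral>\<^sup>+c. g (T c) \<partial>PiM B (\<lambda>_. lborel))"
      unfolding sl using g by (subst nn_integral_distr[OF Tm]) auto
    also have "\<dots> = iter_int (map p bs) (\<lambda>x. g (f x)) 0"
      using iter_int_eq_PiM[OF bs(1) measurable_compose[OF fm g], of p 0] by (simp add: T bs(2))
    finally show ?thesis .
  qed
  then show ?thesis using bs B p ch by (intro exI[of _ bs] exI[of _ p]) simp
qed

lemma sets_subspace_lborel: "sets (subspace_lborel V) = sets (restrict_space borel V)"
  by (simp add: subspace_lborel_def Let_def)

lemma nn_integral_lborel_chain:
  "\<exists>vs. chain {0::'a::euclidean_space} vs UNIV \<and>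
     (\<forall>F\<in>borel_measurable borel. (\<integral>\<^sup>+x. F x \<partial>lborel) = iter_int vs F 0)"
proof -
  obtain bs where bs: "distinct bs" "set bs = (Basis :: 'a set)"
    using finite_distinct_list[OF finite_Basis] by auto
  have "chain {x::'a. x = 0} (map (\<lambda>x. x) bs) {x. x \<in> span (set bs)}"
    using bs independent_Basis by (intro chain_preimage linear_ident) simp_all
  then have "chain {0} bs (UNIV :: 'a set)" using bs by simp
  moreover have "(\<integral>\<^sup>+x. F x \<partial>lborel) = iter_int bs F 0" if F: "F \<in> borel_measurable borel" for F :: "'a \<Rightarrow> ennreal"
  proof -
    have "(\<integral>\<^sup>+x. F x \<partial>lborel) = (\<integral>\<^sup>+c. F (\<Sum>b\<in>Basis. c b *\<^sub>R b) \<partial>(PiM Basis (\<lambda>_. lborel)))"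
      by (subst lborel_eq, rule nn_integral_distr) (use F in measurable)
    then show ?thesis using iter_int_eq_PiM[OF bs(1) F, of "\<lambda>x. x" 0] bs(2) by simp
  qed
  ultimately show ?thesis by blast
qed

lemma invariant_UNIV_const: "invariant UNIV f \<Longrightarrow> f x = f 0"
  unfolding invariant_def by (metis UNIV_I add_0)

lemma prod_mono_ennreal:
  fixes f g :: "'i \<Rightarrow> ennreal"
  shows "(\<And>i. i \<in> I \<Longrightarrow> f i \<le> g i) \<Longrightarrow> prod f I \<le> prod g I"
  by (induction I rule: infinite_finite_induct) (auto intro: mult_mono)

text \<open>
  Raising a Borel version of \<open>f\<close> to \<open>\<infinity>\<close> on a null set makes it a majorant everywhere. As the
  right-hand side of the inequality is unaffected and the left-hand side is monotone, Borel functions suffice,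
  and null sets never have to be pulled back along the maps.
\<close>

lemma completion_borel_majorant:
  fixes f :: "'a \<Rightarrow> ennreal"
  assumes f: "f \<in> borel_measurable (completion M)"
  shows "\<exists>g\<in>borel_measurable M. (\<forall>x\<in>space M. f x \<le> g x) \<and> (\<integral>\<^sup>+x. g x \<partial>M) = (\<integral>\<^sup>+x. f x \<partial>completion M)"
proof -
  obtain h where h [measurable]: "h \<in> borel_measurable M" and eq: "AE x in M. f x = h x"
    using completion_ex_borel_measurable[OF f] by auto
  obtain Z where Z: "{x\<in>space M. f x \<noteq> h x} \<subseteq> Z" "Z \<in> null_sets M"
    using eq by (auto simp: eventually_ae_filter)
  have [measurable]: "Z \<in> sets M" using Z by auto
  define g where "g x = (if x \<in> Z then top else h x)" for x
  have "g \<in> borel_measurable M" unfolding g_def by measurable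
  moreover have "f x \<le> g x" if "x \<in> space M" for x using that Z(1) by (auto simp: g_def)
  moreover have "AE x in M. g x = f x"
    using AE_not_in[OF Z(2)] eq by eventually_elim (simp add: g_def)
  then have "(\<integral>\<^sup>+x. g x \<partial>M) = (\<integral>\<^sup>+x. f x \<partial>completion M)"
    unfolding nn_integral_completion by (rule nn_integral_cong_AE)
  ultimately show ?thesis by blast
qed

context subspace_arrangement
begin

text \<open>
  Functions on \<open>\<pi>\<^sub>i(H)\<close> correspond to \<open>K i\<close>-invariant functions on \<open>H\<close>: in one direction by
  composition with \<open>\<pi>\<^sub>i\<close>, in the other by composition with the linear section that lifts an orthonormal basis.
\<close>

lemma brascamp_lieb_inequality_iff:
  fixes \<pi> :: "nat \<Rightarrow> 'a \<Rightarrow> 'b::real_inner"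
  assumes lin: "\<And>i. i \<in> {1..N} \<Longrightarrow> linear (\<pi> i)" and K: "\<And>i. i \<in> {1..N} \<Longrightarrow> K i = {x. \<pi> i x = 0}"
    and adm: "admissible \<tau>"
  shows "(\<exists>C::ennreal. C < \<infinity> \<and>
        (\<forall>f :: nat \<Rightarrow> 'b \<Rightarrow> ennreal.
           (\<forall>i\<in>{1..N}. f i \<in> borel_measurable (subspace_lebesgue (range (\<pi> i)))) \<longrightarrow>
           (\<integral>\<^sup>+ x. (\<Prod>i=1..N. ennreal_powr (f i (\<pi> i x)) (\<tau> i)) \<partial>lebesgue)
             \<le> C * (\<Prod>i=1..N.
                  ennreal_powr (\<integral>\<^sup>+ y. f i y \<partial>subspace_lebesgue (range (\<pi> i))) (\<tau> i))))
     \<longleftrightarrow> brascamp_lieb {0} UNIV \<tau>"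
    (is "?ineq \<longleftrightarrow> _")
proof -
  have "\<forall>i\<in>{1..N}. \<exists>bsp. distinct (fst bsp) \<and> orthonormal_basis_of (range (\<pi> i)) (set (fst bsp)) \<and>
      (\<forall>b\<in>set (fst bsp). \<pi> i (snd bsp b) = b) \<and> chain {x. \<pi> i x = 0} (map (snd bsp) (fst bsp)) UNIV \<and>
      (\<forall>g\<in>borel_measurable (restrict_space borel (range (\<pi> i))).
         (\<integral>\<^sup>+y. g y \<partial>subspace_lborel (range (\<pi> i))) = iter_int (map (snd bsp) (fst bsp)) (\<lambda>x. g (\<pi> i x)) 0)"
    using nn_integral_subspace_lborel[OF lin] by simp
  from bchoice[OF this] obtain bsp where bsp: "\<forall>i\<in>{1..N}. distinct (fst (bsp i)) \<and> orthonormal_basis_of (range (\<pi> i)) (set (fst (bsp i))) \<and>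
      (\<forall>b\<in>set (fst (bsp i)). \<pi> i (snd (bsp i) b) = b) \<and> chain {x. \<pi> i x = 0} (map (snd (bsp i)) (fst (bsp i))) UNIV \<and>
      (\<forall>g\<in>borel_measurable (restrict_space borel (range (\<pi> i))).
         (\<integral>\<^sup>+y. g y \<partial>subspace_lborel (range (\<pi> i))) = iter_int (map (snd (bsp i)) (fst (bsp i))) (\<lambda>x. g (\<pi> i x)) 0)"
    by (rule exE)
  define bs where "bs i = fst (bsp i)" for i
  define p where "p i = snd (bsp i)" for i
  have basis: "orthonormal_basis_of (range (\<pi> i)) (set (bs i))"
    and p: "\<And>b. b \<in> set (bs i) \<Longrightarrow> \<pi> i (p i b) = b"
    and ch: "chain {x. \<pi> i x = 0} (map (p i) (bs i)) UNIV"
    and int: "\<And>g. g \<in> borel_measurable (restrict_space borel (range (\<pi> i))) \<Longrightarrow>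
       (\<integral>\<^sup>+y. g y \<partial>subspace_lborel (range (\<pi> i))) = iter_int (map (p i) (bs i)) (\<lambda>x. g (\<pi> i x)) 0"
    if "i \<in> {1..N}" for i
    using bspec[OF bsp that] by (auto simp: bs_def p_def)
  obtain vs where vs: "chain {0::'a} vs UNIV" and lb: "\<And>F. F \<in> borel_measurable borel \<Longrightarrow> (\<integral>\<^sup>+x. F x \<partial>lborel) = iter_int vs F 0"
    using nn_integral_lborel_chain by blast
  have join_zero: "join i {0} = {x. \<pi> i x = 0}" if "i \<in> {1..N}" for i
  proof -
    have "subspace (K i)" unfolding K[OF that] by (rule linear_subspace_kernel[OF lin[OF that]])
    moreover have "{0} \<union> K i = K i" using subspace_0[OF \<open>subspace (K i)\<close>] by auto
    ultimately show ?thesis unfolding join_def K[OF that, symmetric] by (simp add: span_eq_iff[THEN iffD2])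
  qed
  have join_UNIV: "join i UNIV = UNIV" for i using subset_join[of UNIV i] by auto
  obtain ws' where ws': "\<And>i. chain (join i {0}) (ws' i) (join i UNIV)" using join_chain_exists[of "{0}" UNIV] by auto
  \<comment> \<open>chains are indexed by all natural numbers; outside \<open>{1..N}\<close> any chain will do\<close>
  define ws where "ws i = (if i \<in> {1..N} then map (p i) (bs i) else ws' i)" for i
  have ws: "chain (join i {0}) (ws i) (join i UNIV)" for i
    using ch[of i] ws'[of i] join_zero[of i] join_UNIV[of i] by (auto simp: ws_def)
  have \<pi>m: "\<pi> i \<in> borel \<rightarrow>\<^sub>M restrict_space borel (range (\<pi> i))" if "i \<in> {1..N}" for i
    using borel_measurable_linear[OF lin[OF that]] by (intro measurable_restrict_space2) auto
  show ?thesis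
  proof
    assume ?ineq
    then obtain C where C: "C < \<infinity>" "\<And>f :: nat \<Rightarrow> 'b \<Rightarrow> ennreal.
        (\<And>i. i \<in> {1..N} \<Longrightarrow> f i \<in> borel_measurable (subspace_lebesgue (range (\<pi> i)))) \<Longrightarrow>
           (\<integral>\<^sup>+ x. (\<Prod>i=1..N. ennreal_powr (f i (\<pi> i x)) (\<tau> i)) \<partial>lebesgue)
             \<le> C * (\<Prod>i=1..N. ennreal_powr (\<integral>\<^sup>+ y. f i y \<partial>subspace_lebesgue (range (\<pi> i))) (\<tau> i))"
      by blast
    have "brascamp_lieb_bound \<tau> {0} vs ws C"
      unfolding brascamp_lieb_bound_def
    proof (intro allI impI)
      fix g :: "nat \<Rightarrow> 'a \<Rightarrow> ennreal" and x
      assume "\<forall>i\<in>{1..N}. g i \<in> borel_measurable borel \<and> invariant (join i {0}) (g i)"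
      then have g: "\<And>i. i \<in> {1..N} \<Longrightarrow> g i \<in> borel_measurable borel" "\<And>i. i \<in> {1..N} \<Longrightarrow> invariant (join i {0}) (g i)"
        by auto
      let ?G = "\<lambda>x. \<Prod>i=1..N. ennreal_powr (g i x) (\<tau> i)"
      define f where "f i y = g i (\<Sum>b\<in>set (bs i). (y \<bullet> b) *\<^sub>R p i b)" for i y
      have f\<pi>: "f i (\<pi> i z) = g i z" if i: "i \<in> {1..N}" for i z
      proof -
        let ?s = "\<Sum>b\<in>set (bs i). (\<pi> i z \<bullet> b) *\<^sub>R p i b"
        have "\<pi> i ?s = (\<Sum>b\<in>set (bs i). (\<pi> i z \<bullet> b) *\<^sub>R b)"
          using p[OF i] by (simp add: linear_sum[OF lin[OF i]] linear_scale[OF lin[OF i]])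
        also have "\<dots> = \<pi> i z"
          using basis[OF i] by (intro orthonormal_basis_expand) (auto simp: orthonormal_basis_of_def)
        finally have "?s - z \<in> join i {0}" by (simp add: join_zero[OF i] linear_diff[OF lin[OF i]])
        then have "g i (z + (?s - z)) = g i z" using g(2)[OF i] unfolding invariant_def by blast
        then show ?thesis by (simp add: f_def)
      qed
      have fm: "f i \<in> borel_measurable (restrict_space borel (range (\<pi> i)))" if i: "i \<in> {1..N}" for i
      proof -
        have [measurable]: "(\<lambda>y. y \<bullet> b) \<in> borel_measurable borel" for b :: 'b
          by (intro borel_measurable_continuous_onI continuous_intros)
        have "(\<lambda>y. \<Sum>b\<in>set (bs i). (y \<bullet> b) *\<^sub>R p i b) \<in> borel_measurable borel" by measurable
        then have "f i \<in> borel_measurable borel" unfolding f_def using g(1)[OF i] by (rule measurable_compose)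
        then show ?thesis by (rule measurable_restrict_space1)
      qed
      have "iter_int vs ?G x = iter_int vs ?G 0"
        by (rule invariant_UNIV_const, rule invariant_iter_int[OF _ _ subspace_single_0 vs])
          (intro measurable_prod_powr invariant_prod_powr g; assumption)+
      also have "\<dots> = (\<integral>\<^sup>+x. ?G x \<partial>lebesgue)"
        using lb measurable_prod_powr[of "{1..N}" g] g by (simp add: nn_integral_completion)
      also have "\<dots> = (\<integral>\<^sup>+x. (\<Prod>i=1..N. ennreal_powr (f i (\<pi> i x)) (\<tau> i)) \<partial>lebesgue)"
        by (simp add: f\<pi>)
      also have "\<dots> \<le> C * (\<Prod>i=1..N. ennreal_powr (\<integral>\<^sup>+ y. f i y \<partial>subspace_lebesgue (range (\<pi> i))) (\<tau> i))"
        using fm by (intro C(2)) (auto simp: subspace_lebesgue_def intro!: measurable_completion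
            simp: measurable_cong_sets[OF sets_subspace_lborel refl])
      also have "(\<Prod>i=1..N. ennreal_powr (\<integral>\<^sup>+ y. f i y \<partial>subspace_lebesgue (range (\<pi> i))) (\<tau> i))
          = (\<Prod>i=1..N. ennreal_powr (iter_int (ws i) (g i) x) (\<tau> i))"
      proof (intro prod.cong refl)
        fix i assume i: "i \<in> {1..N}"
        have "(\<integral>\<^sup>+ y. f i y \<partial>subspace_lebesgue (range (\<pi> i))) = iter_int (ws i) (g i) 0"
          using i int[OF i fm[OF i]] by (simp add: subspace_lebesgue_def nn_integral_completion ws_def f\<pi>[OF i])
        also have "\<dots> = iter_int (ws i) (g i) x"
          using invariant_UNIV_const invariant_iter_int[OF g(1)[OF i] g(2)[OF i] subspace_join ws] unfolding join_UNIV by metis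
        finally show "ennreal_powr (\<integral>\<^sup>+ y. f i y \<partial>subspace_lebesgue (range (\<pi> i))) (\<tau> i)
            = ennreal_powr (iter_int (ws i) (g i) x) (\<tau> i)" by simp
      qed
      finally show "iter_int vs ?G x \<le> C * (\<Prod>i=1..N. ennreal_powr (iter_int (ws i) (g i) x) (\<tau> i))" .
    qed
    then show "brascamp_lieb {0} UNIV \<tau>" unfolding brascamp_lieb_def using vs ws C(1) by blast
  next
    assume "brascamp_lieb {0} UNIV \<tau>"
    then obtain C where C: "C < \<infinity>" "brascamp_lieb_bound \<tau> {0} vs ws C"
      using brascamp_lieb_any_chain[OF _ subspace_single_0 adm vs ws] by auto
    show ?ineq
    proof (intro exI[of _ C] conjI C(1) allI impI)
      fix f :: "nat \<Rightarrow> 'b \<Rightarrow> ennreal"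
      assume f: "\<forall>i\<in>{1..N}. f i \<in> borel_measurable (subspace_lebesgue (range (\<pi> i)))"
      have "\<forall>i\<in>{1..N}. \<exists>g. g \<in> borel_measurable (subspace_lborel (range (\<pi> i))) \<and>
          (\<forall>y\<in>space (subspace_lborel (range (\<pi> i))). f i y \<le> g y) \<and>
          (\<integral>\<^sup>+y. g y \<partial>subspace_lborel (range (\<pi> i))) = (\<integral>\<^sup>+y. f i y \<partial>subspace_lebesgue (range (\<pi> i)))"
        using f completion_borel_majorant unfolding subspace_lebesgue_def by blast
      from bchoice[OF this] obtain g where g0: "\<forall>i\<in>{1..N}. g i \<in> borel_measurable (subspace_lborel (range (\<pi> i))) \<and>
          (\<forall>y\<in>space (subspace_lborel (range (\<pi> i))). f i y \<le> g i y) \<and>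
          (\<integral>\<^sup>+y. g i y \<partial>subspace_lborel (range (\<pi> i))) = (\<integral>\<^sup>+y. f i y \<partial>subspace_lebesgue (range (\<pi> i)))"
        by (rule exE)
      have gm: "g i \<in> borel_measurable (restrict_space borel (range (\<pi> i)))" if "i \<in> {1..N}" for i
        using bspec[OF g0 that] by (simp add: measurable_cong_sets[OF sets_subspace_lborel refl])
      have le: "f i (\<pi> i x) \<le> g i (\<pi> i x)" if "i \<in> {1..N}" for i x
      proof -
        have "space (subspace_lborel (range (\<pi> i))) = range (\<pi> i)"
          using sets_eq_imp_space_eq[OF sets_subspace_lborel] by (simp add: space_restrict_space)
        then show ?thesis using bspec[OF g0 that] by auto
      qed
      define h where "h i x = g i (\<pi> i x)" for i x
      have hm: "h i \<in> borel_measurable borel" if "i \<in> {1..N}" for i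
        unfolding h_def by (rule measurable_compose[OF \<pi>m gm]) (use that in auto)
      have hinv: "invariant (join i {0}) (h i)" if "i \<in> {1..N}" for i
        unfolding join_zero[OF that] invariant_def h_def by (simp add: linear_add[OF lin[OF that]])
      have "(\<integral>\<^sup>+ x. (\<Prod>i=1..N. ennreal_powr (f i (\<pi> i x)) (\<tau> i)) \<partial>lebesgue)
          \<le> (\<integral>\<^sup>+ x. (\<Prod>i=1..N. ennreal_powr (h i x) (\<tau> i)) \<partial>lebesgue)"
        using le adm by (intro nn_integral_mono prod_mono_ennreal) (auto simp: h_def admissible_def intro!: ennreal_powr_mono)
      also have "\<dots> = iter_int vs (\<lambda>x. \<Prod>i=1..N. ennreal_powr (h i x) (\<tau> i)) 0"
        using lb measurable_prod_powr[of "{1..N}" h] hm by (simp add: nn_integral_completion)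
      also have "\<dots> \<le> C * (\<Prod>i=1..N. ennreal_powr (iter_int (ws i) (h i) 0) (\<tau> i))"
        by (intro brascamp_lieb_boundD[OF C(2)] hm hinv)
      also have "(\<Prod>i=1..N. ennreal_powr (iter_int (ws i) (h i) 0) (\<tau> i))
          = (\<Prod>i=1..N. ennreal_powr (\<integral>\<^sup>+ y. f i y \<partial>subspace_lebesgue (range (\<pi> i))) (\<tau> i))"
      proof (intro prod.cong refl)
        fix i assume i: "i \<in> {1..N}"
        have "iter_int (ws i) (h i) 0 = (\<integral>\<^sup>+ y. f i y \<partial>subspace_lebesgue (range (\<pi> i)))"
          using int[OF i gm[OF i]] bspec[OF g0 i] i by (simp add: ws_def h_def[abs_def])
        then show "ennreal_powr (iter_int (ws i) (h i) 0) (\<tau> i)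
            = ennreal_powr (\<integral>\<^sup>+ y. f i y \<partial>subspace_lebesgue (range (\<pi> i))) (\<tau> i)" by simp
      qed
      finally show "(\<integral>\<^sup>+ x. (\<Prod>i=1..N. ennreal_powr (f i (\<pi> i x)) (\<tau> i)) \<partial>lebesgue)
          \<le> C * (\<Prod>i=1..N. ennreal_powr (\<integral>\<^sup>+ y. f i y \<partial>subspace_lebesgue (range (\<pi> i))) (\<tau> i))" .
    qed
  qed
qed

end

theorem theorem1:
  fixes N :: nat
    and Hs :: "nat \<Rightarrow> 'b::{real_inner, complete_space} set"
    and \<pi> :: "nat \<Rightarrow> 'a::euclidean_space \<Rightarrow> 'b"
    and \<tau> :: "nat \<Rightarrow> real"
  assumes "\<And>i. i \<in> {1..N} \<Longrightarrow> subspace (Hs i)"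
    and "\<And>i. i \<in> {1..N} \<Longrightarrow> closed (Hs i)"
    and "\<And>i. i \<in> {1..N} \<Longrightarrow> linear (\<pi> i)"
    and "\<And>i. i \<in> {1..N} \<Longrightarrow> range (\<pi> i) \<subseteq> Hs i"
    and "\<And>i. i \<in> {1..N} \<Longrightarrow> \<tau> i \<in> {0..1}"
  shows
    "(\<exists>C::ennreal. C < \<infinity> \<and>
        (\<forall>f :: nat \<Rightarrow> 'b \<Rightarrow> ennreal.
           (\<forall>i\<in>{1..N}. f i \<in> borel_measurable (subspace_lebesgue (range (\<pi> i)))) \<longrightarrow>
           (\<integral>\<^sup>+ x. (\<Prod>i=1..N. ennreal_powr (f i (\<pi> i x)) (\<tau> i)) \<partial>lebesgue)
             \<le> C * (\<Prod>i=1..N.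
                  ennreal_powr (\<integral>\<^sup>+ y. f i y \<partial>subspace_lebesgue (range (\<pi> i))) (\<tau> i))))
     \<longleftrightarrow>
     (\<exists>G \<theta>. valid_presentation G \<theta> N \<pi> \<tau>)"
proof -
  define K where "K i = {x. \<pi> i x = 0}" for i
  interpret subspace_arrangement N K .
  have adm: "admissible \<tau>" using assms(5) by (simp add: admissible_def)
  have lin: "linear (\<pi> i)" "K i = {x. \<pi> i x = 0}" if "i \<in> {1..N}" for i
    using assms(3)[OF that] by (simp_all add: K_def)
  have proper: "{0::'a} \<subset> UNIV"
    using zero_neq_UNIV by auto
  have "brascamp_lieb {0} UNIV \<tau> \<longleftrightarrow> feasible \<tau> {0} UNIV"
    using brascamp_lieb_imp_feasible[OF _ adm] feasible_imp_brascamp_lieb[OF subspace_single_0 subspace_UNIV proper adm] by blast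
  also have "\<dots> \<longleftrightarrow> (\<exists>G \<theta>. valid_presentation G \<theta> N \<pi> \<tau>)"
  proof
    assume "feasible \<tau> {0} UNIV"
    then obtain E \<theta> where "presentation {0} UNIV \<tau> E \<theta>"
      using feasible_imp_presentation[OF subspace_single_0 subspace_UNIV proper adm] by blast
    from presentation_imp_valid_presentation[OF lin this] show "\<exists>G \<theta>. valid_presentation G \<theta> N \<pi> \<tau>" by blast
  next
    assume "\<exists>G \<theta>. valid_presentation G \<theta> N \<pi> \<tau>"
    then obtain G \<theta> where "valid_presentation G \<theta> N \<pi> \<tau>" by blast
    from valid_presentation_imp_feasible[OF lin this] show "feasible \<tau> {0} UNIV" .
  qed
  finally show ?thesis using brascamp_lieb_inequality_iff[OF lin adm] by simp
qed

end
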